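(* Let $G=(V,E,w)$ be an $n$-vertex weighted undirected graph with polynomial aspect ratio, let $h,k\in\mathbb{N}$ with $h,k\ge1$, and let $r\in V$. Then there is a path-tree one-to-many embedding $f$ of $G$ into a tree $T$ with hop-bound $O(k\cdot\log^2n)\cdot h$, with $|f(V)|\le(2n)^{1+\frac1k}$ and $|f(r)|=1$, such that for every connected $h$-respecting subgraph $H$ of $G$ there is a connected subgraph $H'$ of $T$ such that for every $u\in V(H)$, $H'$ contains some vertex from $f(u)$, and $w_T(H')\le O(k\cdot\log n)\cdot w(H)$.
   Context: Graphs are undirected with finite positive edge weights (only the output tree $T$ may have edges of weight $\infty$). $d_G^{(h)}(u,v)$ is the minimum weight of a $u$-$v$ path in $G$ with at most $h$ edges ($\infty$ if none); $\mathrm{hop}(P)$ is the number of edges of a path $P$. $w(H)$, $w_T(H')$ denote total edge weight. A subgraph $H$ of $G$ is $h$-respecting if $d_G^{(h)}(u,v)\le d_H(u,v)$ for all $u,v\in V(H)$, where $d_H$ is the shortest path distance in $H$. The aspect ratio of $G$ is $\max_{e}w(e)/\min_{e}w(e)$; "polynomial" means at most $n^c$ for a fixed constant $c$ (constants in $O(\cdot)$ may depend on $c$; logarithmic factors inside $O(\cdot)$ are understood to be at least $1$). A one-to-many embedding $f:V\to2^{V(T)}$ sends each vertex to a non-empty set of copies, the sets $f(v)$ being pairwise disjoint; $f(A)=\bigcup_{v\in A}f(v)$. It is dominating if $d_G(u,v)\le d_T(u',v')$ for all $u'\in f(u),v'\in f(v)$. A path-tree one-to-many embedding of $G$ consists of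 a dominating one-to-many embedding $f$ into a tree $T$ with $f(V)=V(T)$, together with, for every edge $e=\{u',v'\}\in E(T)$ with $u'\in f(u),v'\in f(v)$, an associated path $P_e^T$ in $G$ from $u$ to $v$ of weight at most $w_T(e)$. Edges of weight $\infty$ represent disconnection: they carry no associated path, and two vertices of $T$ are called connected in $T$ if the $T$-path between them uses only finite-weight edges. For $u',v'$ connected in $T$ by the simple path $e_1,\dots,e_s$, $P^T_{u'v'}=P^T_{e_1}\circ\cdots\circ P^T_{e_s}$ is the concatenation (not necessarily simple). $f$ has hop-bound $\beta$ if $\mathrm{hop}(P^T_{u'v'})\le\beta$ for all $u',v'\in V(T)$ connected in $T$. *)

theory Defs
  imports Complex_Main "HOL-Library.Extended_Nonnegative_Real"
begin

(* Edges are doubletons. Weights live in [0,\<infinity>] so that one type serves both the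
   finitely weighted input graphs and trees with edges of weight \<infinity>; the weight function
   is meaningful on edges only. *)
record 'a wgraph =
  verts :: "'a set"
  edges :: "'a set set"
  wt :: "'a set \<Rightarrow> ennreal"

definition wf_wgraph :: "'a wgraph \<Rightarrow> bool" where
  "wf_wgraph G \<longleftrightarrow>
     finite (verts G) \<and>
     edges G \<subseteq> {{u, v} | u v. u \<in> verts G \<and> v \<in> verts G \<and> u \<noteq> v} \<and>
     (\<forall>e\<in>edges G. 0 < wt G e)"

definition finite_weights :: "'a wgraph \<Rightarrow> bool" where
  "finite_weights G \<longleftrightarrow> (\<forall>e\<in>edges G. wt G e < \<infinity>)"

definition weight :: "'a wgraph \<Rightarrow> ennreal" where
  "weight G = (\<Sum>e\<in>edges G. wt G e)"

(* The supremum and infimum are a maximum and minimum over a finite nonempty edge set;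
   an edgeless graph gets aspect ratio 0 / \<infinity> = 0. *)
definition aspect_ratio :: "'a wgraph \<Rightarrow> ennreal" where
  "aspect_ratio G = (SUP e\<in>edges G. wt G e) / (INF e\<in>edges G. wt G e)"

lemma aspect_ratio_eq_Max_Min:
  assumes "finite (edges G)" "edges G \<noteq> {}"
  shows "aspect_ratio G = Max (wt G ` edges G) / Min (wt G ` edges G)"
  using assms by (simp add: aspect_ratio_def Max_Sup Min_Inf)

definition subgraph :: "'a wgraph \<Rightarrow> 'a wgraph \<Rightarrow> bool" where
  "subgraph H G \<longleftrightarrow>
     wf_wgraph H \<and> verts H \<subseteq> verts G \<and> edges H \<subseteq> edges G \<and>
     (\<forall>e\<in>edges H. wt H e = wt G e)"

(* Walks are nonempty vertex lists. *)
definition walk_edges :: "'a list \<Rightarrow> 'a set list" where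
  "walk_edges p = map2 (\<lambda>x y. {x, y}) p (tl p)"

definition walk_weight :: "'a wgraph \<Rightarrow> 'a list \<Rightarrow> ennreal" where
  "walk_weight G p = sum_list (map (wt G) (walk_edges p))"

definition hop :: "'a list \<Rightarrow> nat" where
  "hop p = length (walk_edges p)"

definition is_walk :: "'a wgraph \<Rightarrow> 'a \<Rightarrow> 'a list \<Rightarrow> 'a \<Rightarrow> bool" where
  "is_walk G u p v \<longleftrightarrow>
     p \<noteq> [] \<and> hd p = u \<and> last p = v \<and>
     set p \<subseteq> verts G \<and> set (walk_edges p) \<subseteq> edges G"

definition is_path :: "'a wgraph \<Rightarrow> 'a \<Rightarrow> 'a list \<Rightarrow> 'a \<Rightarrow> bool" where
  "is_path G u p v \<longleftrightarrow> is_walk G u p v \<and> distinct p"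

definition wdist :: "'a wgraph \<Rightarrow> 'a \<Rightarrow> 'a \<Rightarrow> ennreal" where
  "wdist G u v = (INF p\<in>{p. is_path G u p v}. walk_weight G p)"

definition hop_dist :: "nat \<Rightarrow> 'a wgraph \<Rightarrow> 'a \<Rightarrow> 'a \<Rightarrow> ennreal" where
  "hop_dist h G u v = (INF p\<in>{p. is_path G u p v \<and> hop p \<le> h}. walk_weight G p)"

definition respecting :: "nat \<Rightarrow> 'a wgraph \<Rightarrow> 'a wgraph \<Rightarrow> bool" where
  "respecting h G H \<longleftrightarrow> (\<forall>u\<in>verts H. \<forall>v\<in>verts H. hop_dist h G u v \<le> wdist H u v)"

definition connected_wgraph :: "'a wgraph \<Rightarrow> bool" where
  "connected_wgraph G \<longleftrightarrow>
     verts G \<noteq> {} \<and> (\<forall>u\<in>verts G. \<forall>v\<in>verts G. \<exists>p. is_path G u p v)"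

(* The second conjunct excludes cycles: a path on at least three vertices whose end vertices
   are adjacent. Edges of weight \<infinity> count as edges here. *)
definition tree :: "'a wgraph \<Rightarrow> bool" where
  "tree T \<longleftrightarrow>
     connected_wgraph T \<and>
     (\<forall>u v p. is_path T u p v \<and> 3 \<le> length p \<longrightarrow> {v, u} \<notin> edges T)"

definition one_to_many_embedding :: "'a wgraph \<Rightarrow> 'b wgraph \<Rightarrow> ('a \<Rightarrow> 'b set) \<Rightarrow> bool" where
  "one_to_many_embedding G T f \<longleftrightarrow>
     (\<forall>v\<in>verts G. f v \<noteq> {} \<and> f v \<subseteq> verts T) \<and>
     (\<forall>u\<in>verts G. \<forall>v\<in>verts G. u \<noteq> v \<longrightarrow> f u \<inter> f v = {})"

definition dominating :: "'a wgraph \<Rightarrow> 'b wgraph \<Rightarrow> ('a \<Rightarrow> 'b set) \<Rightarrow> bool" where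
  "dominating G T f \<longleftrightarrow>
     (\<forall>u\<in>verts G. \<forall>v\<in>verts G. \<forall>u'\<in>f u. \<forall>v'\<in>f v. wdist G u v \<le> wdist T u' v')"

(* P u' v' is the path associated with the edge {u', v'}, read from the side of u' to the side
   of v'; reading the same edge in the other direction reverses the path. *)
definition path_tree_embedding ::
  "'a wgraph \<Rightarrow> 'b wgraph \<Rightarrow> ('a \<Rightarrow> 'b set) \<Rightarrow> ('b \<Rightarrow> 'b \<Rightarrow> 'a list) \<Rightarrow> bool" where
  "path_tree_embedding G T f P \<longleftrightarrow>
     wf_wgraph T \<and> tree T \<and>
     one_to_many_embedding G T f \<and> dominating G T f \<and>
     (\<Union>v\<in>verts G. f v) = verts T \<and>
     (\<forall>u\<in>verts G. \<forall>v\<in>verts G. \<forall>u'\<in>f u. \<forall>v'\<in>f v.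
        {u', v'} \<in> edges T \<and> wt T {u', v'} < \<infinity> \<longrightarrow>
          is_path G u (P u' v') v \<and>
          walk_weight G (P u' v') \<le> wt T {u', v'} \<and>
          P v' u' = rev (P u' v'))"

(* Consecutive walks share an end vertex, which is kept once. The empty concatenation is [],
   which has 0 hops. *)
definition walk_concat :: "'a list list \<Rightarrow> 'a list" where
  "walk_concat ps = foldr (\<lambda>p q. p @ tl q) ps []"

definition induced_walk :: "('b \<Rightarrow> 'b \<Rightarrow> 'a list) \<Rightarrow> 'b list \<Rightarrow> 'a list" where
  "induced_walk P q = walk_concat (map2 P q (tl q))"

(* In a tree, q below is the only path from u' to v'. *)
definition hop_bound :: "'b wgraph \<Rightarrow> ('b \<Rightarrow> 'b \<Rightarrow> 'a list) \<Rightarrow> real \<Rightarrow> bool" where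
  "hop_bound T P \<beta> \<longleftrightarrow>
     (\<forall>u'\<in>verts T. \<forall>v'\<in>verts T. \<forall>q.
        is_path T u' q v' \<and> (\<forall>e\<in>set (walk_edges q). wt T e < \<infinity>) \<longrightarrow>
          real (hop (induced_walk P q)) \<le> \<beta>)"

(* Logarithmic factors in asymptotic bounds are at least 1. *)
definition log1 :: "nat \<Rightarrow> real" where
  "log1 n = max 1 (log 2 (real n))"

end

theory Submission
  imports Defs
begin

text \<open>
Level \<open>i\<close> of the hierarchy has a radius \<open>D i\<close>, halved from level to level, with \<open>D 0 = \<infinity>\<close>; a
cluster of level \<open>i\<close> lies within \<open>O(k log n) h\<close> hops and weight \<open>D i\<close> of its centre. It is
cut up by growing balls \<open>A \<subseteq> A'\<close>: the ball \<open>A'\<close> becomes a cluster of the next level, the rest \<open>X - A\<close> is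
cut up further, and the vertices of \<open>A' - A\<close> are duplicated. The vertex \<open>r\<close> is always chosen as
the first centre, so it is never duplicated. The layer \<open>A' - A\<close> has width of order
\<open>D i / (k log (|X| / |Y|))\<close>, where \<open>Y\<close> is one of \<open>A'\<close> and \<open>X - A\<close>, and it is thin enough for the number of
copies to stay below \<open>|X| powr (1 + 1 / k)\<close>. Joining two parts of the tree inside a cluster of level \<open>i\<close>
costs at most \<open>4 D i\<close>. A closed walk through an \<open>h\<close>-respecting subgraph can be cut such
that every cut is paid for by a crossing of the layer next to a piece in \<open>Y\<close>,
at a rate of \<open>O(k log (|X| / |Y|))\<close> per unit of length. These rates telescope along the nested clusters that contain
the piece, giving \<open>O(k log n)\<close> independently of the number of levels.
\<close>

section \<open>Walks\<close>

lemma walk_edges_simps [simp]: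
  "walk_edges [] = []" "walk_edges [x] = []"
  "walk_edges (x # y # p) = {x, y} # walk_edges (y # p)"
  by (simp_all add: walk_edges_def)

lemma walk_edges_append:
  "p \<noteq> [] \<Longrightarrow> q \<noteq> [] \<Longrightarrow> walk_edges (p @ q) = walk_edges p @ {last p, hd q} # walk_edges q"
proof (induction p rule: induct_list012)
  case (2 x) then show ?case by (cases q) auto
qed auto

lemma walk_edges_join:
  "p \<noteq> [] \<Longrightarrow> q \<noteq> [] \<Longrightarrow> last p = hd q \<Longrightarrow> walk_edges (p @ tl q) = walk_edges p @ walk_edges q"
  by (cases q; cases "tl q") (auto simp: walk_edges_append)

lemma walk_edges_rev: "walk_edges (rev p) = rev (walk_edges p)"
proof (induction p rule: induct_list012)
  case (3 x y zs)
  have "walk_edges (rev (x # y # zs)) = walk_edges (rev (y # zs)) @ [{y, x}]"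
    using walk_edges_append[of "rev (y # zs)" "[x]"] by simp
  with 3 show ?case by (simp add: insert_commute)
qed auto

lemma length_walk_edges: "length (walk_edges p) = length p - 1"
  by (simp add: walk_edges_def)

lemma is_walk_single: "u \<in> verts G \<Longrightarrow> is_walk G u [u] u"
  by (simp add: is_walk_def)

lemma is_walk_join:
  assumes "is_walk G u p v" "is_walk G v q w"
  shows "is_walk G u (p @ tl q) w"
    and "walk_weight G (p @ tl q) = walk_weight G p + walk_weight G q"
    and "hop (p @ tl q) = hop p + hop q"
proof -
  have e: "walk_edges (p @ tl q) = walk_edges p @ walk_edges q"
    using assms by (intro walk_edges_join) (auto simp: is_walk_def)
  show "is_walk G u (p @ tl q) w"
    using assms unfolding is_walk_def e
    by (cases q; cases "tl q") (auto simp: last_append)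
  show "walk_weight G (p @ tl q) = walk_weight G p + walk_weight G q"
    by (simp add: walk_weight_def e)
  show "hop (p @ tl q) = hop p + hop q"
    by (simp add: hop_def e)
qed

lemma is_walk_rev: "is_walk G u p v \<Longrightarrow> is_walk G v (rev p) u"
  by (auto simp: is_walk_def walk_edges_rev hd_rev last_rev)

lemma walk_weight_rev: "walk_weight G (rev p) = walk_weight G p"
  by (simp add: walk_weight_def walk_edges_rev rev_map[symmetric])

lemma hop_rev: "hop (rev p) = hop p"
  by (simp add: hop_def walk_edges_rev)

lemma is_path_rev: "is_path G u p v \<Longrightarrow> is_path G v (rev p) u"
  by (auto simp: is_path_def is_walk_rev)

text \<open>Cutting out the closed part between two occurrences of a vertex only drops edges, so
  neither hops nor weight increase.\<close>

lemma walk_to_path: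
  assumes "is_walk G u p v"
  obtains q where "is_path G u q v" "hop q \<le> hop p" "walk_weight G q \<le> walk_weight G p"
proof -
  have "\<exists>q. is_path G u q v \<and> hop q \<le> hop p \<and> walk_weight G q \<le> walk_weight G p"
    using assms
  proof (induction "length p" arbitrary: p rule: less_induct)
    case less
    show ?case
    proof (cases "distinct p")
      case True
      with less.prems show ?thesis by (auto simp: is_path_def)
    next
      case False
      then obtain xs ys zs y where p: "p = xs @ [y] @ ys @ [y] @ zs"
        using not_distinct_decomp by blast
      let ?a = "xs @ [y]" and ?b = "y # ys @ [y]" and ?c = "y # zs"
      have p': "p = ?a @ tl (?b @ tl ?c)" by (simp add: p)
      have e: "walk_edges p = walk_edges ?a @ walk_edges ?b @ walk_edges ?c"
        unfolding p'
        using walk_edges_join[of ?a "?b @ tl ?c"] walk_edges_join[of ?b ?c] by simp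
      have e': "walk_edges (xs @ y # zs) = walk_edges ?a @ walk_edges ?c"
        using walk_edges_join[of ?a ?c] by simp
      have "is_walk G u (xs @ y # zs) v"
        using less.prems unfolding is_walk_def e e' by (cases xs) (auto simp: p last_append split: if_splits)
      moreover have "hop (xs @ y # zs) \<le> hop p" by (simp add: hop_def e e')
      moreover have "walk_weight G (xs @ y # zs) \<le> walk_weight G p"
        by (simp add: walk_weight_def e e')
      moreover have "length (xs @ y # zs) < length p" by (simp add: p)
      ultimately show ?thesis using less.hyps order_trans by meson
    qed
  qed
  with that show ?thesis by blast
qed

section \<open>Reachability within bounded hops and weight\<close>

definition near :: "'a wgraph \<Rightarrow> nat \<Rightarrow> ennreal \<Rightarrow> 'a \<Rightarrow> 'a \<Rightarrow> bool" where
  "near G b d u v \<longleftrightarrow> (\<exists>p. is_walk G u p v \<and> hop p \<le> b \<and> walk_weight G p \<le> d)"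

lemma near_refl: "u \<in> verts G \<Longrightarrow> near G b d u u"
  unfolding near_def using is_walk_single[of u G]
  by (intro exI[of _ "[u]"]) (auto simp: hop_def walk_weight_def)

lemma near_sym: "near G b d u v \<Longrightarrow> near G b d v u"
  unfolding near_def by (metis is_walk_rev hop_rev walk_weight_rev)

lemma near_trans:
  assumes "near G b d u v" "near G b' d' v w"
  shows "near G (b + b') (d + d') u w"
proof -
  obtain p q where "is_walk G u p v" "hop p \<le> b" "walk_weight G p \<le> d"
    "is_walk G v q w" "hop q \<le> b'" "walk_weight G q \<le> d'"
    using assms unfolding near_def by blast
  then show ?thesis unfolding near_def
    by (intro exI[of _ "p @ tl q"]) (simp add: is_walk_join add_mono)
qed

lemma near_mono: "near G b d u v \<Longrightarrow> b \<le> b' \<Longrightarrow> d \<le> d' \<Longrightarrow> near G b' d' u v"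
  unfolding near_def by (meson order_trans)

text \<open>The walks in \<open>near\<close> make it transitive by concatenation; a path is
  recovered only where one is needed.\<close>

lemma nearE_path:
  assumes "near G b d u v"
  obtains p where "is_path G u p v" "hop p \<le> b" "walk_weight G p \<le> d"
  using assms unfolding near_def by (meson walk_to_path order_trans)

text \<open>With a strict inequality the infimum yields a witness outright, whether or not it is
  attained.\<close>

lemma near_if_hop_dist_less: "hop_dist h G u v < d \<Longrightarrow> near G h d u v"
  unfolding hop_dist_def near_def INF_less_iff by (auto simp: is_path_def intro: less_imp_le)

lemma hop_dist_sym: "hop_dist h G u v = hop_dist h G v u"
proof -
  have "hop_dist h G u v \<le> hop_dist h G v u" for u v
    unfolding hop_dist_def
  proof (rule INF_mono)
    fix p assume "p \<in> {p. is_path G v p u \<and> hop p \<le> h}"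
    then show "\<exists>q\<in>{p. is_path G u p v \<and> hop p \<le> h}. walk_weight G q \<le> walk_weight G p"
      by (intro bexI[of _ "rev p"]) (auto simp: hop_rev walk_weight_rev is_path_rev)
  qed
  then show ?thesis by (simp add: antisym)
qed

lemma wdist_le_walk_weight: "is_walk G u p v \<Longrightarrow> wdist G u v \<le> walk_weight G p"
  unfolding wdist_def by (erule walk_to_path) (auto intro: INF_lower2)

lemma walk_weight_simps [simp]:
  "walk_weight G [] = 0" "walk_weight G [x] = 0"
  "walk_weight G (x # y # p) = wt G {x, y} + walk_weight G (y # p)"
  by (simp_all add: walk_weight_def)

lemma is_walk_Cons:
  "is_walk G u (x # y # p) v \<longleftrightarrow> u = x \<and> x \<in> verts G \<and> {x, y} \<in> edges G \<and> is_walk G y (y # p) v"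
  by (auto simp: is_walk_def)

lemma connected_if_walks_to:
  assumes "t \<in> verts G" "\<And>y. y \<in> verts G \<Longrightarrow> \<exists>p. is_walk G y p t"
  shows "connected_wgraph G"
  unfolding connected_wgraph_def
proof (intro conjI ballI)
  show "verts G \<noteq> {}" using assms(1) by blast
  fix u v assume "u \<in> verts G" "v \<in> verts G"
  then obtain p q where "is_walk G u p t" "is_walk G v q t" using assms(2) by meson
  then have "is_walk G u (p @ tl (rev q)) v" by (intro is_walk_join(1) is_walk_rev)
  then show "\<exists>p. is_path G u p v" using walk_to_path by metis
qed

lemma hop_eq_length: "hop p = length p - 1"
  by (simp add: hop_def length_walk_edges)

lemma hop_induced_walk_le:
  assumes "\<And>x y. {x, y} \<in> set (walk_edges q) \<Longrightarrow> hop (P x y) \<le> b"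
  shows "hop (induced_walk P q) \<le> b * (length q - 1)"
  using assms
proof (induction q rule: induct_list012)
  case (3 x y q)
  have "hop (induced_walk P (y # q)) \<le> b * (length (y # q) - 1)"
    by (rule "3.IH") (use 3(3) in auto)
  moreover have "hop (P x y) \<le> b" by (rule 3(3)) simp
  moreover have "hop (induced_walk P (x # y # q)) \<le> hop (P x y) + hop (induced_walk P (y # q))"
    by (simp add: induced_walk_def walk_concat_def hop_eq_length)
  ultimately show ?case by simp
qed (simp_all add: induced_walk_def walk_concat_def hop_def)

text \<open>Towards domination: \<open>\<phi>\<close> sends a copy to its original vertex, and
  replacing each tree edge by its path projects a walk in \<open>T\<close> to one in
  \<open>G\<close> that is no heavier. The weight is assumed finite since infinite edges have no
  path.\<close>

lemma project_walk:
  assumes edge: "\<And>x y. {x, y} \<in> edges T \<Longrightarrow> wt T {x, y} < \<infinity> \<Longrightarrow>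
      \<exists>p. is_walk G (\<phi> x) p (\<phi> y) \<and> walk_weight G p \<le> wt T {x, y}"
    and verts: "\<And>x. x \<in> verts T \<Longrightarrow> \<phi> x \<in> verts G"
  shows "is_walk T u q v \<Longrightarrow> walk_weight T q < \<infinity> \<Longrightarrow>
    \<exists>p. is_walk G (\<phi> u) p (\<phi> v) \<and> walk_weight G p \<le> walk_weight T q"
proof (induction q arbitrary: u rule: induct_list012)
  case (2 x)
  then have "is_walk G (\<phi> u) [\<phi> u] (\<phi> v)" by (auto simp: is_walk_def verts)
  then show ?case by fastforce
next
  case (3 x y q)
  have w: "u = x" "{x, y} \<in> edges T" "is_walk T y (y # q) v" using 3(3) by (auto simp: is_walk_Cons)
  have fin: "wt T {x, y} < \<infinity>" "walk_weight T (y # q) < \<infinity>" using 3(4) by (auto simp: less_top)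
  obtain p1 where p1: "is_walk G (\<phi> x) p1 (\<phi> y)" "walk_weight G p1 \<le> wt T {x, y}" using edge w fin by blast
  obtain p2 where p2: "is_walk G (\<phi> y) p2 (\<phi> v)" "walk_weight G p2 \<le> walk_weight T (y # q)"
    using 3(2)[OF w(3) fin(2)] by blast
  show ?case
    using is_walk_join[OF p1(1) p2(1)] p1(2) p2(2) w(1) by (intro exI[of _ "p1 @ tl p2"]) (simp add: add_mono)
qed (simp add: is_walk_def)

lemma edge_leaving:
  assumes H: "is_walk H u p v" and "u \<in> S" "v \<notin> S"
  shows "\<exists>x y. {x, y} \<in> edges H \<and> x \<in> S \<and> y \<in> verts H - S"
  using assms
proof (induction p arbitrary: u rule: induct_list012)
  case (3 x y p)
  have w: "u = x" "{x, y} \<in> edges H" "is_walk H y (y # p) v" using 3(3) by (auto simp: is_walk_Cons)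
  show ?case
  proof (cases "y \<in> S")
    case True
    from 3(2)[OF w(3) True 3(5)] show ?thesis .
  next
    case False
    have "y \<in> verts H" using w(3) by (auto simp: is_walk_def)
    then show ?thesis using w 3(4) False by blast
  qed
qed (auto simp: is_walk_def)

text \<open>The walk gains one vertex at a time: an edge from a visited \<open>x\<close> to a new
  \<open>y\<close> is inserted as a detour \<open>x, y, x\<close>. All edges of \<open>F\<close>,
  the edges used so far, have both ends visited, so the new edge is not in \<open>F\<close> and each
  edge is paid for once, at twice its weight.\<close>

lemma double_tree_walk:
  assumes wf: "wf_wgraph H" and conn: "connected_wgraph H"
  obtains u p v where "is_walk H u p v" "set p = verts H" "walk_weight H p \<le> 2 * weight H"
proof -
  have finV: "finite (verts H)" using wf by (simp add: wf_wgraph_def)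
  have "edges H \<subseteq> Pow (verts H)" using wf by (auto simp: wf_wgraph_def)
  then have finE: "finite (edges H)" using finV finite_subset by blast
  obtain u where u: "u \<in> verts H" using conn by (auto simp: connected_wgraph_def)
  have "\<exists>v p F. is_walk H u p v \<and> m \<le> card (set p) \<and> F \<subseteq> edges H \<and> (\<forall>e\<in>F. e \<subseteq> set p) \<and>
      walk_weight H p \<le> 2 * sum (wt H) F" if "m \<le> card (verts H)" for m
    using that
  proof (induction m)
    case 0
    show ?case using is_walk_single[OF u]
      by (intro exI[of _ u] exI[of _ "[u]"] exI[of _ "{}"]) auto
  next
    case (Suc m)
    then obtain v p F where p: "is_walk H u p v" "m \<le> card (set p)" "F \<subseteq> edges H" "\<forall>e\<in>F. e \<subseteq> set p"
      "walk_weight H p \<le> 2 * sum (wt H) F" by force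
    show ?case
    proof (cases "Suc m \<le> card (set p)")
      case True
      then show ?thesis using p by blast
    next
      case False
      then have "set p \<noteq> verts H" using Suc.prems by auto
      moreover have "set p \<subseteq> verts H" "u \<in> set p" using p(1) by (auto simp: is_walk_def)
      ultimately obtain z where z: "z \<in> verts H" "z \<notin> set p" by blast
      obtain q where "is_walk H u q z" using conn u z(1) by (auto simp: connected_wgraph_def is_path_def)
      from edge_leaving[OF this \<open>u \<in> set p\<close> z(2)]
      obtain x y where xy: "{x, y} \<in> edges H" "x \<in> set p" "y \<in> verts H" "y \<notin> set p" by blast
      obtain p1 p2 where p12: "p = p1 @ x # p2" using xy(2) split_list by metis
      let ?a = "p1 @ [x]" and ?b = "x # p2"
      have e: "walk_edges p = walk_edges ?a @ walk_edges ?b"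
        using walk_edges_join[of ?a ?b] by (simp add: p12)
      have a: "is_walk H u ?a x" and b: "is_walk H x ?b v"
        using p(1) unfolding is_walk_def e by (cases p1; auto simp: p12)+
      have c: "is_walk H x [x, y, x] x"
        using xy \<open>set p \<subseteq> verts H\<close> by (auto simp: is_walk_def insert_commute)
      let ?p = "(?a @ tl [x, y, x]) @ tl ?b"
      have w: "is_walk H u ?p v" by (rule is_walk_join(1)[OF is_walk_join(1)[OF a c] b])
      have "walk_weight H ?p = walk_weight H p + 2 * wt H {x, y}"
        using is_walk_join(2)[OF is_walk_join(1)[OF a c] b] is_walk_join(2)[OF a c]
        by (simp add: walk_weight_def e insert_commute mult_2 ac_simps)
      also have "\<dots> \<le> 2 * sum (wt H) (insert {x, y} F)"
      proof -
        have "{x, y} \<notin> F" using p(4) xy(4) by blast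
        moreover have "finite F" using p(3) finE finite_subset by blast
        ultimately show ?thesis using p(5) by (simp add: distrib_left add.commute add_left_mono)
      qed
      finally have "walk_weight H ?p \<le> 2 * sum (wt H) (insert {x, y} F)" .
      moreover have sp: "set ?p = insert y (set p)" by (auto simp: p12)
      moreover have "Suc m \<le> card (set ?p)" unfolding sp using p(2) xy(4) by simp
      moreover have "insert {x, y} F \<subseteq> edges H" using p(3) xy(1) by blast
      moreover have "\<forall>e\<in>insert {x, y} F. e \<subseteq> set ?p" unfolding sp using p(4) xy(2) by blast
      ultimately show ?thesis using w by blast
    qed
  qed
  from this[OF order_refl] obtain v p F where p: "is_walk H u p v" "card (verts H) \<le> card (set p)" "F \<subseteq> edges H"
    "walk_weight H p \<le> 2 * sum (wt H) F" by blast
  have "set p \<subseteq> verts H" using p(1) by (simp add: is_walk_def)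
  then have "set p = verts H" using p(2) finV by (simp add: card_seteq)
  moreover have "walk_weight H p \<le> 2 * weight H"
    unfolding weight_def using p(3,4) finE by (meson mult_left_mono order_trans sum_mono2 zero_le)
  ultimately show ?thesis using that p(1) by blast
qed

lemma walk_split:
  assumes "is_walk H u p v" "i < length p"
  shows "is_walk H u (take (Suc i) p) (p ! i)" "is_walk H (p ! i) (drop i p) v"
    "p = take (Suc i) p @ tl (drop i p)"
proof -
  have 1: "p = take (Suc i) p @ tl (drop i p)"
    by (simp only: tl_drop drop_Suc[symmetric] append_take_drop_id)
  then show "p = take (Suc i) p @ tl (drop i p)" .
  have "last (take (Suc i) p) = p ! i" "hd (drop i p) = p ! i"
    using assms(2) by (simp_all add: take_Suc_conv_app_nth hd_drop_conv_nth)
  moreover have "walk_edges p = walk_edges (take (Suc i) p) @ walk_edges (drop i p)"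
    by (subst 1, subst walk_edges_join) (use assms(2) calculation in auto)
  ultimately show "is_walk H u (take (Suc i) p) (p ! i)" "is_walk H (p ! i) (drop i p) v"
    using assms by (auto simp: is_walk_def dest: in_set_takeD in_set_dropD)
qed

section \<open>Rooted trees as weighted graphs\<close>

text \<open>\<open>U\<close> contains the vertices other than the root \<open>\<rho>\<close>. The
  rank grows strictly away from the root, so it excludes cycles, drives inductions towards the root
  and bounds depths by \<open>L\<close>; \<open>ew\<close> gives the weight of the edge above a
  vertex from the rank of that vertex.\<close>

locale rooted_tree =
  fixes U :: "'b set" and \<rho> :: 'b and par :: "'b \<Rightarrow> 'b" and rk :: "'b \<Rightarrow> nat" and L :: nat and ew :: "nat \<Rightarrow> ennreal"
  assumes finU: "finite U" and root: "\<rho> \<notin> U" and root_rank: "rk \<rho> = 0"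
    and par: "y \<in> U \<Longrightarrow> par y \<in> insert \<rho> U"
    and rank: "y \<in> U \<Longrightarrow> rk (par y) < rk y"
    and rank_le: "y \<in> U \<Longrightarrow> rk y \<le> L"
    and ew: "y \<in> U \<Longrightarrow> 0 < ew (rk y)"
begin

text \<open>The maximal rank on an edge is the rank of its lower end, since parents have smaller rank.\<close>
definition sub_tree :: "'b set \<Rightarrow> 'b \<Rightarrow> 'b wgraph" where
  "sub_tree S t = \<lparr>verts = S, edges = (\<lambda>y. {y, par y}) ` (S - {t}), wt = \<lambda>e. ew (Max (rk ` e))\<rparr>"

definition tree_graph :: "'b wgraph" where
  "tree_graph = sub_tree (insert \<rho> U) \<rho>"

lemma sub_tree_simps [simp]:
  "verts (sub_tree S t) = S" "edges (sub_tree S t) = (\<lambda>y. {y, par y}) ` (S - {t})"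
  "wt (sub_tree S t) e = ew (Max (rk ` e))"
  by (simp_all add: sub_tree_def)

lemma tree_graph_simps [simp]:
  "verts tree_graph = insert \<rho> U" "edges tree_graph = (\<lambda>y. {y, par y}) ` U"
  "wt tree_graph e = ew (Max (rk ` e))"
  using root by (simp_all add: tree_graph_def)

lemma par_neq: "y \<in> U \<Longrightarrow> par y \<noteq> y"
  using rank by fastforce

lemma weight_edge: "y \<in> U \<Longrightarrow> ew (Max (rk ` {y, par y})) = ew (rk y)"
  using rank[of y] by (simp add: max_def)

lemma edge_cases:
  assumes "{x, y} \<in> edges tree_graph"
  obtains "x \<in> U" "y = par x" | "y \<in> U" "x = par y"
  using assms by (auto simp: doubleton_eq_iff)

text \<open>Climbing from any vertex of \<open>S\<close> stays in \<open>S\<close> until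
  \<open>t\<close> is reached, so these are the vertex sets of connected subtrees with highest
  vertex \<open>t\<close>.\<close>

definition pruned :: "'b set \<Rightarrow> 'b \<Rightarrow> bool" where
  "pruned S t \<longleftrightarrow> S \<subseteq> insert \<rho> U \<and> t \<in> S \<and> (\<forall>y\<in>S - {t}. y \<in> U \<and> par y \<in> S)"

text \<open>Every vertex climbs to \<open>t\<close> inside \<open>S\<close> by decreasing rank. Two
  vertices cannot be parents of each other, so distinct vertices own distinct edges and the weight
  becomes a sum over vertices.\<close>

lemma pruned_subgraph:
  assumes S: "pruned S t"
  shows "subgraph (sub_tree S t) tree_graph" "connected_wgraph (sub_tree S t)"
    "weight (sub_tree S t) = (\<Sum>y\<in>S - {t}. ew (rk y))"
proof -
  have S': "S \<subseteq> insert \<rho> U" "t \<in> S" "\<And>y. y \<in> S \<Longrightarrow> y \<noteq> t \<Longrightarrow> y \<in> U" "\<And>y. y \<in> S \<Longrightarrow> y \<noteq> t \<Longrightarrow> par y \<in> S"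
    using S by (auto simp: pruned_def)
  have "finite S" using S'(1) finU finite_subset by blast
  moreover have "edges (sub_tree S t) \<subseteq> {{u, v} |u v. u \<in> S \<and> v \<in> S \<and> u \<noteq> v}"
  proof
    fix e assume "e \<in> edges (sub_tree S t)"
    then obtain y where "y \<in> S" "y \<noteq> t" "e = {y, par y}" by auto
    then show "e \<in> {{u, v} |u v. u \<in> S \<and> v \<in> S \<and> u \<noteq> v}"
      using S'(3,4)[of y] par_neq[of y] by (intro CollectI exI[of _ y] exI[of _ "par y"]) simp
  qed
  moreover have "0 < wt (sub_tree S t) e" if e: "e \<in> edges (sub_tree S t)" for e
  proof -
    obtain y where "y \<in> U" "e = {y, par y}" using e S'(3) by auto
    then show ?thesis using weight_edge ew by simp
  qed
  ultimately have "wf_wgraph (sub_tree S t)" by (auto simp: wf_wgraph_def)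
  moreover have "edges (sub_tree S t) \<subseteq> edges tree_graph" using S'(3) by auto
  ultimately show "subgraph (sub_tree S t) tree_graph"
    using S'(1) by (auto simp: subgraph_def)
  have "\<exists>p. is_walk (sub_tree S t) y p t" if "y \<in> S" for y
    using that
  proof (induction "rk y" arbitrary: y rule: less_induct)
    case less
    show ?case
    proof (cases "y = t")
      case True
      then show ?thesis using less.prems is_walk_single[of t "sub_tree S t"] by auto
    next
      case False
      note y = S'(3)[OF less.prems False] S'(4)[OF less.prems False]
      obtain p where p: "is_walk (sub_tree S t) (par y) p t" using less.hyps[OF rank[OF y(1)] y(2)] by blast
      have "is_walk (sub_tree S t) y [y, par y] (par y)"
        using less.prems y False by (auto simp: is_walk_def)
      from is_walk_join(1)[OF this p] show ?thesis by blast
    qed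
  qed
  then show "connected_wgraph (sub_tree S t)"
    by (intro connected_if_walks_to[of t]) (auto simp: S'(2))
  have "inj_on (\<lambda>y. {y, par y}) (S - {t})"
  proof
    fix y z assume yz: "y \<in> S - {t}" "z \<in> S - {t}" "{y, par y} = {z, par z}"
    then have U: "y \<in> U" "z \<in> U" using S'(3) by auto
    show "y = z"
    proof (rule ccontr)
      assume "y \<noteq> z"
      then have "y = par z" "z = par y" using yz(3) by (auto simp: doubleton_eq_iff)
      then show False using rank[OF U(1)] rank[OF U(2)] by simp
    qed
  qed
  then have "weight (sub_tree S t) = (\<Sum>y\<in>S - {t}. ew (Max (rk ` {y, par y})))"
    unfolding weight_def sub_tree_simps by (simp add: sum.reindex)
  also have "\<dots> = (\<Sum>y\<in>S - {t}. ew (rk y))"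
    by (rule sum.cong) (use S'(3) in \<open>auto simp del: image_insert intro!: weight_edge\<close>)
  finally show "weight (sub_tree S t) = (\<Sum>y\<in>S - {t}. ew (rk y))" .
qed

section \<open>The whole tree, its path lengths and the absence of cycles\<close>

lemma pruned_all: "pruned (insert \<rho> U) \<rho>"
  using par by (auto simp: pruned_def)

lemma tree_graph_wf: "wf_wgraph tree_graph" and tree_graph_connected: "connected_wgraph tree_graph"
  using pruned_subgraph[OF pruned_all] by (auto simp: subgraph_def simp flip: tree_graph_def)

text \<open>After one step down, a step up would return to the vertex just left, so a path keeps
  descending and the rank grows by at least 1 per edge.\<close>

lemma descending_path:
  "distinct (a # b # q) \<Longrightarrow> set (walk_edges (a # b # q)) \<subseteq> edges tree_graph \<Longrightarrow> b \<in> U \<Longrightarrow> a = par b \<Longrightarrow>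
    rk a + length (b # q) \<le> rk (last (b # q))"
proof (induction q arbitrary: a b)
  case Nil
  then show ?case using rank[of b] by simp
next
  case (Cons c q)
  have "{b, c} \<in> edges tree_graph" using Cons.prems(2) by simp
  then have c: "c \<in> U" "b = par c"
    using Cons.prems(1,4) by (auto elim!: edge_cases simp del: tree_graph_simps)
  have "rk b + length (c # q) \<le> rk (last (c # q))"
    by (rule Cons.IH) (use Cons.prems c in auto)
  then show ?case using rank[of b] Cons.prems(3,4) by simp
qed

text \<open>A path first climbs and then only descends. Climbing uses at most the rank of its start,
  descending at most the rank of its end.\<close>

lemma path_length_le:
  "p \<noteq> [] \<Longrightarrow> distinct p \<Longrightarrow> set (walk_edges p) \<subseteq> edges tree_graph \<Longrightarrow> length p - 1 \<le> rk (hd p) + rk (last p)"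
proof (induction p rule: induct_list012)
  case (3 x y q)
  have "{x, y} \<in> edges tree_graph" using 3(5) by simp
  then show ?case
  proof (cases rule: edge_cases)
    case 1
    have "length (y # q) - 1 \<le> rk (hd (y # q)) + rk (last (y # q))"
      by (rule 3(2)) (use 3(4,5) in auto)
    then show ?thesis using rank[OF 1(1)] 1(2) by simp
  next
    case 2
    then show ?thesis using descending_path[OF 3(4,5)] by simp
  qed
qed auto

lemma rank_le': "y \<in> insert \<rho> U \<Longrightarrow> rk y \<le> L"
  using rank_le root_rank by auto

lemma tree_tree_graph: "tree tree_graph"
  unfolding tree_def
proof (intro conjI tree_graph_connected allI impI)
  \<comment> \<open>Read from \<open>v\<close>, the path has at least three vertices and ends in
    \<open>u\<close>, so it cannot start with the edge to \<open>u\<close>. Hence it descends all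
    the way, and \<open>u\<close> would outrank its child \<open>v\<close>.\<close>
  have no: False if p: "is_path tree_graph u p v" "3 \<le> length p" and v: "v \<in> U" "u = par v" for u v p
  proof -
    have r: "is_path tree_graph v (rev p) u" by (rule is_path_rev[OF p(1)])
    obtain v' w x q where q: "rev p = v' # w # x # q"
      using p(2) unfolding length_rev[of p, symmetric] numeral_3_eq_3 Suc_le_length_iff by blast
    have d: "v' = v" "distinct (v # w # x # q)" "set (walk_edges (v # w # x # q)) \<subseteq> edges tree_graph"
      "last (x # q) = u"
      using r unfolding q is_path_def is_walk_def by (auto simp del: tree_graph_simps)
    have "w \<noteq> u" using d(2,4) by (metis distinct.simps(2) last_in_set list.distinct(1))
    moreover have "{v, w} \<in> edges tree_graph" using d(3) by simp
    ultimately have w: "w \<in> U" "v = par w" using v by (auto elim!: edge_cases simp del: tree_graph_simps)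
    have "rk v + length (w # x # q) \<le> rk u"
      using descending_path[OF d(2,3) w] d(4) by simp
    then show False using rank[OF v(1)] v(2) by simp
  qed
  fix u v p assume p: "is_path tree_graph u p v \<and> 3 \<le> length p"
  show "{v, u} \<notin> edges tree_graph"
  proof
    assume "{v, u} \<in> edges tree_graph"
    then show False
    proof (cases rule: edge_cases)
      case 1
      show False by (rule no[OF conjunct1[OF p] conjunct2[OF p] 1])
    next
      case 2
      show False by (rule no[OF is_path_rev[OF conjunct1[OF p]] _ 2]) (use p in simp)
    qed
  qed
qed

end

section \<open>Growing a cluster\<close>

text \<open>Here \<open>y\<close> and \<open>z\<close> are the sizes of two overlapping pieces, and
  \<open>y'\<close> counts the part of the first that is outside the second. The last hypothesis
  says \<open>y powr (1 + 1 / k) \<le> y' * N powr (1 / k)\<close>, so the duplicates are absorbed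
  and the two bounds add up to \<open>(y' + z) * N powr (1 / k)\<close>.\<close>

lemma powr_sum_le_if_small_side:
  fixes y y' z N :: real
  assumes "0 < y'" "0 < y" "y \<le> N" "0 \<le> z" "z \<le> N" "0 < k" "N = z + y'"
    and "log 2 y - log 2 y' \<le> (log 2 N - log 2 y) / k"
  shows "y powr (1 + 1 / k) + z powr (1 + 1 / k) \<le> N powr (1 + 1 / k)"
proof -
  have "log 2 (y powr (1 + 1 / k)) \<le> log 2 (y' * N powr (1 / k))"
    using assms by (simp add: log_mult log_powr algebra_simps diff_divide_distrib)
  then have "y powr (1 + 1 / k) \<le> y' * N powr (1 / k)"
    using assms by (subst (asm) log_le_cancel_iff) auto
  moreover have "z powr (1 + 1 / k) \<le> z * N powr (1 / k)"
    using assms by (cases "z = 0") (auto simp: powr_add intro!: mult_left_mono powr_mono2)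
  ultimately have "y powr (1 + 1 / k) + z powr (1 + 1 / k) \<le> (z + y') * N powr (1 / k)"
    by (simp add: algebra_simps)
  then show ?thesis using assms by (simp add: powr_add)
qed

text \<open>
Upper bound for the total width, in units in which the step out of a ball of size \<open>b\<close> has width
\<open>1 / log 2 (N / min b (N - b))\<close>, that is used up when the growth reaches size \<open>b\<close> without success.
Failure means that \<open>log 2 (N / b)\<close> shrinks, respectively that \<open>log 2 (N / (N - b))\<close> grows, by more than the factor
\<open>1 + 1 / k\<close>, so the widths form a geometric series on either side of \<open>N / 2\<close>.
\<close>
definition growth_potential :: "real \<Rightarrow> real \<Rightarrow> real \<Rightarrow> real" where
  "growth_potential k N b = (if 2 * b \<le> N then k / (log 2 N - log 2 b)
     else (2 * k + 2) - (k + 1) / (log 2 N - log 2 (N - b)))"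

lemma log_diff_ge_1: "0 < b \<Longrightarrow> 2 * b \<le> N \<Longrightarrow> 1 \<le> log 2 N - log 2 b"
  using log_le_cancel_iff[of 2 "2 * b" N] by (simp add: log_mult)

text \<open>
\<open>E s A\<close> stands for the neighbourhood of \<open>A\<close> of width \<open>s\<close>, and \<open>R t A\<close> for the assertion that \<open>A\<close> lies within
distance \<open>t\<close> of \<open>v\<close>; the premise \<open>1 \<le> s * log 2 n\<close> bounds the number of steps.
\<close>
lemma growing_cluster:
  fixes X :: "'a set" and k :: real
  assumes fin: "finite X" and v: "v \<in> X" and n: "card X \<le> n" and k: "1 \<le> k"
    and E: "\<And>A s. A \<subseteq> X \<Longrightarrow> 0 \<le> s \<Longrightarrow> A \<subseteq> E s A \<and> E s A \<subseteq> X"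
    and R0: "R 0 {v}"
    and R: "\<And>t s A. R t A \<Longrightarrow> A \<subseteq> X \<Longrightarrow> 0 \<le> t \<Longrightarrow> 0 < s \<Longrightarrow> 1 \<le> s * log 2 n \<Longrightarrow> R (t + s) (E s A)"
  obtains A A' t s where "v \<in> A" "A \<subseteq> A'" "A' \<subseteq> X" "R t A'" "0 \<le> t" "t \<le> 4 * k"
    "card A' powr (1 + 1 / k) + card (X - A) powr (1 + 1 / k) \<le> card X powr (1 + 1 / k)"
    "A' = X \<and> A = X \<or> A' = E s A \<and> 0 < s \<and> A' \<noteq> X \<and> (\<exists>Y\<in>{A', X - A}. 1 \<le> 2 * s * (log 2 (card X) - log 2 (card Y)))"
proof -
  define N where "N = real (card X)"
  let ?good = "\<lambda>A A' t s. v \<in> A \<and> A \<subseteq> A' \<and> A' \<subseteq> X \<and> R t A' \<and> 0 \<le> t \<and> t \<le> 4 * k \<and>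
    card A' powr (1 + 1 / k) + card (X - A) powr (1 + 1 / k) \<le> card X powr (1 + 1 / k) \<and>
    (A' = X \<and> A = X \<or> A' = E s A \<and> 0 < s \<and> A' \<noteq> X \<and> (\<exists>Y\<in>{A', X - A}. 1 \<le> 2 * s * (log 2 (card X) - log 2 (card Y))))"
  \<comment> \<open>If the ball fills \<open>X\<close>, nothing is cut off and nothing is
    duplicated.\<close>
  have whole: "\<exists>A A' t s. ?good A A' t s" if "R t X" "0 \<le> t" "t \<le> 4 * k" for t
    using that v by (intro exI[of _ X] exI[of _ t]) auto
  have step: "\<exists>A A' t s. ?good A A' t s"
    if "A \<subseteq> X" "v \<in> A" "A \<noteq> X" "R t A" "0 \<le> t" "t \<le> growth_potential k N (card A)" for A t
    using that
  proof (induction "card X - card A" arbitrary: A t rule: less_induct)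
    case less
    define b where "b = real (card A)"
    have finA: "finite A" using less.prems fin finite_subset by blast
    have cA: "card A < card X" using less.prems fin by (meson psubsetI psubset_card_mono)
    have b: "1 \<le> b" "b < N" "1 \<le> N - b"
      using less.prems finA cA by (auto simp: b_def N_def Suc_le_eq card_gt_0_iff)
    \<comment> \<open>The logarithm of the ratio of \<open>N\<close> to the smaller of the two
      sides, hence at least 1; the next step has width \<open>1 / x\<close>.\<close>
    define x where "x = log 2 N - log 2 (if 2 * b \<le> N then b else N - b)"
    have x1: "1 \<le> x" unfolding x_def
      using log_diff_ge_1[of b N] log_diff_ge_1[of "N - b" N] b by auto
    have xn: "x \<le> log 2 n"
    proof -
      have "log 2 N \<le> log 2 n" using n b by (simp add: N_def)
      moreover have "0 \<le> log 2 (if 2 * b \<le> N then b else N - b)" using b by simp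
      ultimately show ?thesis unfolding x_def by linarith
    qed
    define s where "s = 1 / x"
    have s: "0 < s" "s \<le> 1" "1 \<le> s * log 2 n" using x1 xn by (auto simp: s_def field_simps)
    define A' where "A' = E s A"
    define b' where "b' = real (card A')"
    have A': "A \<subseteq> A'" "A' \<subseteq> X" using E[OF less.prems(1), of s] s by (auto simp: A'_def)
    have finA': "finite A'" using A' fin finite_subset by blast
    have bb': "b \<le> b'" "b' \<le> N" using A' fin finA' by (auto simp: b_def b'_def N_def card_mono)
    have R': "R (t + s) A'" unfolding A'_def using R less.prems s by blast
    have IH: "\<exists>A A' t s. ?good A A' t s"
      if "b < b'" "A' \<noteq> X" "t + s \<le> growth_potential k N b'"
    proof -
      have "card X - card A' < card X - card A" using that(1) cA by (simp add: b_def b'_def)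
      moreover have "0 \<le> t + s" using less.prems s by simp
      moreover have "v \<in> A'" using A' less.prems by blast
      ultimately show ?thesis using less.hyps[of A' "t + s"] that(2,3) A' R' unfolding b'_def by blast
    qed
    have cXA: "real (card (X - A)) = N - b" 
      using less.prems finA cA by (simp add: card_Diff_subset b_def N_def)
    show ?case
    proof (cases "2 * b \<le> N")
      case small: True
      have x: "x = log 2 N - log 2 b" using small by (simp add: x_def)
      have t: "t \<le> k / x" using less.prems(6) small by (simp add: growth_potential_def x b_def)
      have ts: "t + s \<le> (k + 1) / x" using t by (simp add: s_def add_divide_distrib)
      have ts4: "t + s \<le> 4 * k" 
      proof -
        have "(k + 1) / x \<le> (k + 1) / 1" using x1 k by (intro divide_left_mono) auto
        with ts k show ?thesis by simp
      qed
      show ?thesis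
      proof (cases "A' = X")
        case True
        then show ?thesis using whole[of "t + s"] R' ts4 less.prems s by simp
      next
        case nX: False
        then have b'N: "b' < N" using A' fin by (simp add: b'_def N_def psubset_card_mono psubsetI)
        show ?thesis
        proof (cases "2 * b' \<le> N")
          case small': True
          define x' where "x' = log 2 N - log 2 b'"
          have x'1: "1 \<le> x'" unfolding x'_def using log_diff_ge_1[of b' N] b bb' small' by auto
          \<comment> \<open>The test is the hypothesis of \<open>powr_sum_le_if_small_side\<close>
            for \<open>y = b'\<close> and \<open>y' = b\<close>. If it holds, the growth stops with
            \<open>Y = A'\<close>; otherwise \<open>(k + 1) / x \<le> k / x'\<close>, so the
            potential rises by at least \<open>s\<close>.\<close>
          show ?thesis
          proof (cases "x \<le> (1 + 1 / k) * x'")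
            case True
            have "x \<le> 2 * x'"
            proof -
              have "(1 + 1 / k) * x' \<le> 2 * x'" using k x'1 by (intro mult_right_mono) auto
              with True show ?thesis by simp
            qed
            then have "1 \<le> 2 * s * (log 2 (card X) - log 2 (card A'))"
              using x1 by (simp add: s_def x'_def N_def b'_def field_simps)
            moreover have "b' powr (1 + 1 / k) + (N - b) powr (1 + 1 / k) \<le> N powr (1 + 1 / k)"
              using b bb' k True
              by (intro powr_sum_le_if_small_side[where y' = b]) (auto simp: x x'_def algebra_simps diff_divide_distrib)
            ultimately show ?thesis
              using less.prems A' R' ts4 s nX
              by (intro exI[of _ A] exI[of _ A'] exI[of _ "t + s"] exI[of _ s])
                (auto simp: cXA b'_def[symmetric] N_def[symmetric] A'_def[symmetric])
          next
            case False
            then have f: "(k + 1) * x' < k * x" using k by (simp add: field_simps)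
            then have "(k + 1) / x \<le> k / x'" using x1 x'1 by (simp add: field_simps)
            \<comment> \<open>Without growth the test would have succeeded, so failure makes the
              induction measure decrease.\<close>
            moreover have "b \<noteq> b'"
            proof
              assume "b = b'"
              then have "x' = x" by (simp add: x x'_def)
              then show False using f x1 by (simp add: algebra_simps)
            qed
            ultimately show ?thesis using IH ts nX small' bb' by (simp add: growth_potential_def x'_def)
          qed
        next
          case big': False
          define z' where "z' = log 2 N - log 2 (N - b')"
          have z'1: "1 \<le> z'" unfolding z'_def using log_diff_ge_1[of "N - b'" N] b'N big' by auto
          \<comment> \<open>The step passes \<open>N / 2\<close>: the width so far is at most
            \<open>(k + 1) / x \<le> k + 1\<close>, and the upper branch of the potential is never
            below \<open>k + 1\<close>.\<close>
          have "(k + 1) / z' \<le> (k + 1) / 1" using z'1 k by (intro divide_left_mono) auto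
          moreover have "(k + 1) / x \<le> (k + 1) / 1" using x1 k by (intro divide_left_mono) auto
          ultimately have "t + s \<le> growth_potential k N b'"
            using ts big' by (simp add: growth_potential_def z'_def[symmetric])
          then show ?thesis using nX small big' bb' by (intro IH) auto
        qed
      qed
    next
      \<comment> \<open>Past \<open>N / 2\<close> the roles are exchanged: \<open>X - A\<close> is
        the smaller side and serves as \<open>Y\<close>, with \<open>X - A'\<close> as the part of
        it outside \<open>A'\<close>.\<close>
      case big: False
      have x: "x = log 2 N - log 2 (N - b)" using big by (simp add: x_def)
      have t: "t \<le> (2 * k + 2) - (k + 1) / x" using less.prems(6) big by (simp add: growth_potential_def x b_def)
      have ts: "t + s \<le> (2 * k + 2) - k / x" using t by (simp add: s_def add_divide_distrib)
      have ts4: "t + s \<le> 4 * k"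
      proof -
        have "0 \<le> k / x" using x1 k by simp
        with ts k show ?thesis by simp
      qed
      show ?thesis
      proof (cases "A' = X")
        case True
        then show ?thesis using whole[of "t + s"] R' ts4 less.prems s by simp
      next
        case nX: False
        then have b'N: "b' < N" using A' fin by (simp add: b'_def N_def psubset_card_mono psubsetI)
        define x' where "x' = log 2 N - log 2 (N - b')"
        have x'1: "1 \<le> x'" unfolding x'_def using log_diff_ge_1[of "N - b'" N] b'N big bb' by auto
        show ?thesis
        proof (cases "x' \<le> (1 + 1 / k) * x")
          case True
          have "1 \<le> 2 * s * (log 2 (card X) - log 2 (card (X - A)))"
            unfolding cXA N_def[symmetric] x[symmetric] using x1 by (simp add: s_def)
          moreover have "(N - b) powr (1 + 1 / k) + b' powr (1 + 1 / k) \<le> N powr (1 + 1 / k)"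
            using b bb' b'N k True
            by (intro powr_sum_le_if_small_side[where y' = "N - b'"]) (auto simp: x x'_def algebra_simps diff_divide_distrib)
          ultimately show ?thesis
            using less.prems A' R' ts4 s nX
            by (intro exI[of _ A] exI[of _ A'] exI[of _ "t + s"] exI[of _ s])
              (auto simp: cXA b'_def[symmetric] N_def[symmetric] A'_def[symmetric] add.commute)
        next
          case False
          then have f: "(k + 1) * x < k * x'" using k by (simp add: field_simps)
          then have "(k + 1) / x' \<le> k / x" using x1 x'1 by (simp add: field_simps)
          moreover have "b \<noteq> b'"
          proof
            assume "b = b'"
            then have "x' = x" by (simp add: x x'_def)
            then show False using f x1 by (simp add: algebra_simps)
          qed
          ultimately show ?thesis using IH ts nX big bb' by (simp add: growth_potential_def x'_def)
        qed
      qed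
    qed
  qed
  have "\<exists>A A' t s. ?good A A' t s"
  proof (cases "X = {v}")
    case True
    then have "R 0 X" using R0 by simp
    then show ?thesis by (rule whole) (use k in auto)
  next
    case False
    have "card X > 1" 
    proof -
      have "{v} \<subset> X" using False v by blast
      from psubset_card_mono[OF fin this] show ?thesis by simp
    qed
    then have "0 \<le> growth_potential k N 1"
      using k by (auto simp: growth_potential_def N_def)
    then show ?thesis
      by (intro step[of "{v}" 0]) (use False v R0 in auto)
  qed
  then show ?thesis
    by (elim exE conjE) (rule that)
qed

section \<open>Cutting a sequence between two overlapping sets\<close>

text \<open>
\<open>Cov a b c\<close>: the entries \<open>v a, \<dots>, v b\<close> can be covered at cost \<open>c\<close>; \<open>M\<close> is the price of joining two covers.
The first entry outside \<open>Z\<close> lies in a maximal run inside \<open>Y\<close>, everything before that run is in \<open>Z\<close>, and the rest is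
handled by induction. Each end of the run that is an actual cut borders on an entry outside \<open>Y\<close>, so
it is paid for by the saving \<open>K - KY\<close> on the stretch between the entry outside \<open>Z\<close> and the one outside \<open>Y\<close>.
\<close>
lemma interval_cover:
  fixes Cov :: "nat \<Rightarrow> nat \<Rightarrow> real \<Rightarrow> bool" and l :: "nat \<Rightarrow> real" and M :: ennreal
  assumes mono: "\<And>a b c c'. Cov a b c \<Longrightarrow> c \<le> c' \<Longrightarrow> Cov a b c'"
    and join: "\<And>a b d c c' m. Cov a b c \<Longrightarrow> Cov (Suc b) d c' \<Longrightarrow> 0 \<le> c \<Longrightarrow> 0 \<le> c' \<Longrightarrow> 0 \<le> m \<Longrightarrow> M \<le> ennreal m \<Longrightarrow>
      a \<le> b \<Longrightarrow> b < d \<Longrightarrow> Cov a d (c + c' + m)"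
    and Y: "\<And>a b. lo \<le> a \<Longrightarrow> a \<le> b \<Longrightarrow> b \<le> hi \<Longrightarrow> v ` {a..b} \<subseteq> Y \<Longrightarrow> Cov a b (KY * (l b - l a))"
    and Z: "\<And>a b. lo \<le> a \<Longrightarrow> a \<le> b \<Longrightarrow> b \<le> hi \<Longrightarrow> v ` {a..b} \<subseteq> Z \<Longrightarrow> Cov a b (KZ * (l b - l a))"
    and K: "0 \<le> KY" "0 \<le> KZ" "KY \<le> K" "KZ \<le> K"
    and l: "\<And>i j. lo \<le> i \<Longrightarrow> i \<le> j \<Longrightarrow> j \<le> hi \<Longrightarrow> l i \<le> l j"
    and cross: "\<And>i j. lo \<le> i \<Longrightarrow> i \<le> j \<Longrightarrow> j \<le> hi \<Longrightarrow>
      v i \<notin> Z \<and> v j \<notin> Y \<or> v i \<notin> Y \<and> v j \<notin> Z \<Longrightarrow> M \<le> ennreal ((K - KY) * (l j - l i))"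
    and YZ: "v ` {lo..hi} \<subseteq> Y \<union> Z"
  shows "lo \<le> a \<Longrightarrow> a \<le> b \<Longrightarrow> b \<le> hi \<Longrightarrow> Cov a b (K * (l b - l a))"
proof (induction "b - a" arbitrary: a rule: less_induct)
  case less
  note ab = less.prems
  have mK: "0 \<le> p * (l j - l i)" if "0 \<le> p" "lo \<le> i" "i \<le> j" "j \<le> hi" for p i j
    using that l by simp
  have mK': "p * (l j - l i) \<le> q * (l j - l i)" if "p \<le> q" "lo \<le> i" "i \<le> j" "j \<le> hi" for p q i j
    using that l by (intro mult_right_mono) auto
  show ?case
  proof (cases "v ` {a..b} \<subseteq> Z")
    case True
    show ?thesis using mono[OF Z[OF ab True]] mK'[OF K(4) ab] by blast
  next
    case False
    define i where "i = (LEAST i. a \<le> i \<and> i \<le> b \<and> v i \<notin> Z)"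
    have ex: "\<exists>i. a \<le> i \<and> i \<le> b \<and> v i \<notin> Z" using False by auto
    then have i: "a \<le> i" "i \<le> b" "v i \<notin> Z" unfolding i_def using LeastI_ex[OF ex] by blast+
    have beforeZ: "v j \<in> Z" if "a \<le> j" "j < i" for j
      using not_less_Least[of j "\<lambda>i. a \<le> i \<and> i \<le> b \<and> v i \<notin> Z"] that i unfolding i_def[symmetric] by auto
    have "v i \<in> v ` {lo..hi}" using i ab by (intro imageI) auto
    then have viY: "v i \<in> Y" using i YZ by blast
    define s where "s = (LEAST s. a \<le> s \<and> s \<le> i \<and> v ` {s..i} \<subseteq> Y)"
    have "\<exists>s. a \<le> s \<and> s \<le> i \<and> v ` {s..i} \<subseteq> Y" using i viY by (intro exI[of _ i]) auto
    from LeastI_ex[OF this] have s: "a \<le> s" "s \<le> i" "v ` {s..i} \<subseteq> Y" unfolding s_def by blast+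
    have s': "v (s - 1) \<notin> Y" if "a < s"
    proof
      assume "v (s - 1) \<in> Y"
      moreover have "{s - 1..i} \<subseteq> insert (s - 1) {s..i}" by auto
      ultimately have "v ` {s - 1..i} \<subseteq> Y" using s(3) by (auto simp: image_subset_iff)
      then show False using not_less_Least[of "s - 1" "\<lambda>s. a \<le> s \<and> s \<le> i \<and> v ` {s..i} \<subseteq> Y"] that s
        unfolding s_def[symmetric] by auto
    qed
    define t where "t = (GREATEST t. i \<le> t \<and> t \<le> b \<and> v ` {i..t} \<subseteq> Y)"
    have "i \<le> t \<and> t \<le> b \<and> v ` {i..t} \<subseteq> Y" unfolding t_def
      by (rule GreatestI_nat[of _ i b]) (use i viY in auto)
    then have t: "i \<le> t" "t \<le> b" "v ` {i..t} \<subseteq> Y" by blast+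
    have t': "v (Suc t) \<notin> Y" if "t < b"
    proof
      assume "v (Suc t) \<in> Y"
      then have "v ` {i..Suc t} \<subseteq> Y" using t by (auto simp: le_Suc_eq image_subset_iff)
      then have "i \<le> Suc t \<and> Suc t \<le> b \<and> v ` {i..Suc t} \<subseteq> Y" using t that by auto
      then have "Suc t \<le> (GREATEST t. i \<le> t \<and> t \<le> b \<and> v ` {i..t} \<subseteq> Y)"
        by (rule Greatest_le_nat[of _ _ b]) blast
      then have "Suc t \<le> t" unfolding t_def[symmetric] .
      then show False by simp
    qed
    have stY: "v ` {s..t} \<subseteq> Y" 
    proof -
      have "{s..t} \<subseteq> {s..i} \<union> {i..t}" by auto
      then show ?thesis using s(3) t(3) by blast
    qed
    have mid: "Cov s t (KY * (l t - l s))" using Y stY s t ab i by simp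
    \<comment> \<open>The cut after \<open>t\<close> is paid for between \<open>i\<close> and
      \<open>Suc t\<close>. The stretch from \<open>s\<close> to \<open>i\<close> is charged at rate
      \<open>KY\<close> only, which leaves its saving for the cut before \<open>s\<close>.\<close>
    have right: "Cov s b (K * (l b - l i) + KY * (l i - l s))"
    proof (cases "t = b")
      case True
      have "KY * (l t - l s) \<le> K * (l b - l i) + KY * (l i - l s)"
        using mK'[OF K(3), of i b] True i ab by (simp add: algebra_simps)
      with mid True mono show ?thesis by blast
    next
      case False
      then have tb: "t < b" using t by simp
      have "Cov (Suc t) b (K * (l b - l (Suc t)))"
        by (rule less.hyps) (use tb t i ab in auto)
      moreover have "M \<le> ennreal ((K - KY) * (l (Suc t) - l i))"
        using cross[of i "Suc t"] t' tb t i ab by auto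
      ultimately have "Cov s b (KY * (l t - l s) + K * (l b - l (Suc t)) + (K - KY) * (l (Suc t) - l i))"
        using s t tb i ab K by (intro join[OF mid]) (auto intro!: mK)
      moreover have "KY * (l t - l s) + K * (l b - l (Suc t)) + (K - KY) * (l (Suc t) - l i)
          \<le> K * (l b - l i) + KY * (l i - l s)"
        using mK[OF K(1), of t "Suc t"] t tb i ab by (simp add: algebra_simps)
      ultimately show ?thesis using mono by blast
    qed
    show ?thesis
    proof (cases "a = s")
      case True
      have "K * (l b - l i) + KY * (l i - l s) \<le> K * (l b - l a)"
        using mK'[OF K(3), of s i] s i ab True by (simp add: algebra_simps)
      with right True mono show ?thesis by blast
    next
      case False
      then have as: "a < s" using s by simp
      have "Cov a (s - 1) (KZ * (l (s - 1) - l a))"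
        by (rule Z) (use as s i ab beforeZ in \<open>auto simp: image_subset_iff\<close>)
      \<comment> \<open>The cut before \<open>s\<close> uses the saving left between
        \<open>s - 1\<close> and \<open>i\<close>.\<close>
      moreover have "M \<le> ennreal ((K - KY) * (l i - l (s - 1)))"
        using cross[of "s - 1" i] s' as s i ab by auto
      moreover have "Cov (Suc (s - 1)) b (K * (l b - l i) + KY * (l i - l s))"
        using right as by simp
      ultimately have "Cov a b (KZ * (l (s - 1) - l a) + (K * (l b - l i) + KY * (l i - l s)) + (K - KY) * (l i - l (s - 1)))"
        
      proof (intro join)
        show "0 \<le> KZ * (l (s - 1) - l a)" "0 \<le> (K - KY) * (l i - l (s - 1))"
          using as s i ab K by (auto intro!: mK)
        show "0 \<le> K * (l b - l i) + KY * (l i - l s)"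
          using as s i ab K by (auto intro!: mK add_nonneg_nonneg)
      qed (use as s i in auto)
      moreover have "KZ * (l (s - 1) - l a) + (K * (l b - l i) + KY * (l i - l s)) + (K - KY) * (l i - l (s - 1))
          \<le> K * (l b - l a)"
      proof -
        have "0 \<le> KY * (l s - l (s - 1))" using as s i ab by (intro mK[OF K(1)]) auto
        moreover have "KZ * (l (s - 1) - l a) \<le> K * (l (s - 1) - l a)" using as s i ab by (intro mK'[OF K(4)]) auto
        ultimately show ?thesis by (simp add: algebra_simps)
      qed
      ultimately show ?thesis using mono by blast
    qed
  qed
qed

text \<open>\<open>l\<close> is a clock: the time between two entries bounds their
  \<open>h\<close>-hop distance. The cutting argument sees an \<open>h\<close>-respecting subgraph
  only through such sequences.\<close>

definition paced :: "nat \<Rightarrow> 'a wgraph \<Rightarrow> (nat \<Rightarrow> 'a) \<Rightarrow> (nat \<Rightarrow> real) \<Rightarrow> nat \<Rightarrow> nat \<Rightarrow> bool" where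
  "paced h G v l a b \<longleftrightarrow> (\<forall>i j. a \<le> i \<and> i \<le> j \<and> j \<le> b \<longrightarrow>
     l i \<le> l j \<and> hop_dist h G (v i) (v j) \<le> ennreal (l j - l i))"

lemma paced_mono: "paced h G v l a b \<Longrightarrow> a \<le> a' \<Longrightarrow> b' \<le> b \<Longrightarrow> paced h G v l a' b'"
  unfolding paced_def by (meson order_trans)

lemma walk_weight_finite:
  assumes "is_walk H u p v" "finite_weights H"
  shows "walk_weight H p < \<infinity>"
proof -
  have "sum_list (map (wt H) es) < \<infinity>" if "set es \<subseteq> edges H" for es
    using that assms(2) by (induction es) (auto simp: finite_weights_def)
  with assms(1) show ?thesis by (auto simp: walk_weight_def is_walk_def)
qed

text \<open>The clock is the weight of the prefix. The part of the walk between two entries lies in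
  \<open>H\<close>, so its weight bounds \<open>wdist H\<close>, and with it
  \<open>hop_dist h G\<close>.\<close>

lemma paced_walk:
  assumes p: "is_walk H u p v" and fw: "finite_weights H" and H: "verts H \<subseteq> verts G" "respecting h G H"
  shows "paced h G (nth p) (\<lambda>i. enn2real (walk_weight H (take (Suc i) p))) 0 (length p - 1)"
  unfolding paced_def
proof (intro allI impI, elim conjE)
  fix i j assume ij: "i \<le> j" "j \<le> length p - 1"
  have "p \<noteq> []" using p by (simp add: is_walk_def)
  then have j: "j < length p" using ij by (cases p) auto
  define q where "q = take (Suc j) p"
  have q: "is_walk H u q (p ! j)" unfolding q_def by (rule walk_split(1)[OF p j])
  have iq: "i < length q" "q ! i = p ! i" "take (Suc i) q = take (Suc i) p"
    using ij j by (auto simp: q_def min_def)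
  note s = walk_split[OF q iq(1), unfolded iq]
  have w: "walk_weight H q = walk_weight H (take (Suc i) p) + walk_weight H (drop i q)"
    using is_walk_join(2)[OF s(1,2)] s(3) by simp
  have fin: "walk_weight H (take (Suc i) p) < \<infinity>" "walk_weight H (drop i q) < \<infinity>"
    using walk_weight_finite[OF _ fw] s(1,2) by blast+
  then have l: "enn2real (walk_weight H q) = enn2real (walk_weight H (take (Suc i) p)) + enn2real (walk_weight H (drop i q))"
    unfolding w by (auto simp: less_top_ennreal simp flip: ennreal_plus)
  have "p ! i \<in> verts H" "p ! j \<in> verts H"
    using p ij j by (auto simp: is_walk_def)
  then have "hop_dist h G (p ! i) (p ! j) \<le> wdist H (p ! i) (p ! j)" using H(2) by (auto simp: respecting_def)
  also have "\<dots> \<le> walk_weight H (drop i q)" by (rule wdist_le_walk_weight[OF s(2)])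
  also have "\<dots> = ennreal (enn2real (walk_weight H q) - enn2real (walk_weight H (take (Suc i) p)))"
    unfolding l using fin by simp
  finally show "enn2real (walk_weight H (take (Suc i) p)) \<le> enn2real (walk_weight H (take (Suc j) p)) \<and>
      hop_dist h G (p ! i) (p ! j)
      \<le> ennreal (enn2real (walk_weight H (take (Suc j) p)) - enn2real (walk_weight H (take (Suc i) p)))"
    unfolding q_def[symmetric] l by simp
qed

section \<open>The hierarchy of clusters\<close>

text \<open>\<open>\<beta>\<close> is the hop radius of a cluster: at most
  \<open>4 * k * log 2 n\<close> growth steps of \<open>h\<close> hops each, for \<open>n\<close>
  vertices. \<open>shrink\<close> stands for halving but also admits
  \<open>D 0 = \<infinity>\<close>, where it says that whatever is within \<open>b\<close> hops is
  also within weight \<open>D 1\<close>. \<open>bottom\<close> makes clusters of level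
  \<open>L\<close> singletons.\<close>

locale hop_hierarchy =
  fixes G :: "'a wgraph" and h k \<beta> L :: nat and D :: "nat \<Rightarrow> ennreal" and r :: 'a
  assumes fin: "finite (verts G)" and k: "1 \<le> k"
    and D: "\<And>i. 2 * D (Suc i) \<le> D i"
    and hops: "\<And>j. real j \<le> 4 * real k * log 2 (card (verts G)) \<Longrightarrow> j * h \<le> \<beta>"
    and shrink: "\<And>i b u v. i < L \<Longrightarrow> near G b (D i * ennreal (1 / 2)) u v \<Longrightarrow> near G b (D (Suc i)) u v"
    and bottom: "\<And>u v. near G \<beta> (D L) u v \<Longrightarrow> u = v"
    and L: "0 < L"
begin

section \<open>Partial trees, their covers and the price of joining covers\<close>

lemma D_antimono: "i \<le> j \<Longrightarrow> D j \<le> D i"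
proof (induction j rule: dec_induct)
  case (step j)
  have "D (Suc j) \<le> 2 * D (Suc j)" by (simp add: mult_2)
  with D[of j] step show ?case by simp
qed simp

text \<open>
Copies of \<open>v\<close> are pairs \<open>(v, m)\<close>. A connected subgraph of a tree given by its parent function is a set \<open>S\<close> closed under parents
except at its top \<open>t\<close>; the edge from \<open>y\<close> to its parent has weight \<open>D (rk y - 1)\<close>.
\<close>
definition covers ::
  "('a \<times> nat) set \<Rightarrow> 'a \<times> nat \<Rightarrow> ('a \<times> nat \<Rightarrow> 'a \<times> nat) \<Rightarrow> ('a \<times> nat \<Rightarrow> nat) \<Rightarrow> (nat \<Rightarrow> 'a) \<Rightarrow> nat \<Rightarrow> nat \<Rightarrow> real \<Rightarrow> bool"
  where "covers U \<rho> par rk v a b c \<longleftrightarrow> (\<exists>S t. S \<subseteq> insert \<rho> U \<and> t \<in> S \<and> (\<forall>y\<in>S - {t}. y \<in> U \<and> par y \<in> S) \<and>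
     (\<Sum>y\<in>S - {t}. D (rk y - 1)) \<le> ennreal c \<and> (\<forall>i\<in>{a..b}. \<exists>y\<in>S. fst y = v i))"

text \<open>The rank of \<open>y\<close> is one more than the level of the cluster in which
  \<open>y\<close> is joined to its parent. Edges of rank 1 get weight \<open>D 0\<close>, which
  will be \<infinity>, so they require no path. The rank of \<open>\<rho>\<close> stays open because
  \<open>\<rho>\<close> may later be attached to another root.\<close>

definition arbor ::
  "nat \<Rightarrow> 'a \<times> nat \<Rightarrow> ('a \<times> nat) set \<Rightarrow> ('a \<times> nat \<Rightarrow> 'a \<times> nat) \<Rightarrow> ('a \<times> nat \<Rightarrow> nat) \<Rightarrow> bool"
  where "arbor i \<rho> U par rk \<longleftrightarrow> finite U \<and> \<rho> \<notin> U \<and>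
     (\<forall>y\<in>U. par y \<in> insert \<rho> U \<and> i < rk y \<and> rk y \<le> L \<and> (par y \<in> U \<longrightarrow> rk (par y) < rk y) \<and>
        (1 < rk y \<longrightarrow> near G \<beta> (D (rk y - 1)) (fst y) (fst (par y))))"

lemma arborD:
  assumes "arbor i \<rho> U par rk"
  shows "finite U" "\<rho> \<notin> U"
    and "\<And>y. y \<in> U \<Longrightarrow> par y \<in> insert \<rho> U" "\<And>y. y \<in> U \<Longrightarrow> i < rk y" "\<And>y. y \<in> U \<Longrightarrow> rk y \<le> L"
    "\<And>y. y \<in> U \<Longrightarrow> par y \<in> U \<Longrightarrow> rk (par y) < rk y"
    "\<And>y. y \<in> U \<Longrightarrow> 1 < rk y \<Longrightarrow> near G \<beta> (D (rk y - 1)) (fst y) (fst (par y))"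
  using assms unfolding arbor_def by blast+

text \<open>The rate depends on the size of \<open>X\<close> but not on the level \<open>i\<close>,
  so the rates of nested clusters telescope; it is 0 for singletons.\<close>

definition hub ::
  "nat \<Rightarrow> 'a \<times> nat \<Rightarrow> 'a set \<Rightarrow> ('a \<times> nat) set \<Rightarrow> ('a \<times> nat \<Rightarrow> 'a \<times> nat) \<Rightarrow> ('a \<times> nat \<Rightarrow> nat) \<Rightarrow> bool"
  where "hub i \<rho> X U par rk \<longleftrightarrow> arbor i \<rho> U par rk \<and> fst ` U \<subseteq> X \<and>
     (\<forall>v l a b. a \<le> b \<and> paced h G v l a b \<and> v ` {a..b} \<subseteq> X \<longrightarrow>
        covers U \<rho> par rk v a b (64 * k * log 2 (card X) * (l b - l a)))"

lemma hubD:
  assumes "hub i \<rho> X U par rk"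
  shows "arbor i \<rho> U par rk" "fst ` U \<subseteq> X"
    and "\<And>v l a b. a \<le> b \<Longrightarrow> paced h G v l a b \<Longrightarrow> v ` {a..b} \<subseteq> X \<Longrightarrow>
        covers U \<rho> par rk v a b (64 * k * log 2 (card X) * (l b - l a))"
  using assms unfolding hub_def by blast+

lemma covers_cong:
  assumes "covers U \<rho> par rk v a b c" "U \<subseteq> U'" "insert \<rho> U \<subseteq> insert \<rho>' U'"
    "\<And>y. y \<in> U \<Longrightarrow> par' y = par y \<and> rk' y = rk y" "c \<le> c'"
  shows "covers U' \<rho>' par' rk' v a b c'"
proof -
  obtain S t where S: "S \<subseteq> insert \<rho> U" "t \<in> S" "\<forall>y\<in>S - {t}. y \<in> U \<and> par y \<in> S"
    "(\<Sum>y\<in>S - {t}. D (rk y - 1)) \<le> ennreal c" "\<forall>i\<in>{a..b}. \<exists>y\<in>S. fst y = v i"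
    using assms(1) unfolding covers_def by blast
  have "(\<Sum>y\<in>S - {t}. D (rk' y - 1)) = (\<Sum>y\<in>S - {t}. D (rk y - 1))"
    by (rule sum.cong) (use S(3) assms(4) in auto)
  also have "\<dots> \<le> ennreal c'"
    using S(4) ennreal_leI[OF assms(5)] by (rule order_trans)
  finally have "(\<Sum>y\<in>S - {t}. D (rk' y - 1)) \<le> ennreal c'" .
  moreover have "\<forall>y\<in>S - {t}. y \<in> U' \<and> par' y \<in> S" using S(3) assms(2,4) by auto
  ultimately show ?thesis unfolding covers_def
    by (intro exI[of _ S] exI[of _ t] conjI order_trans[OF S(1) assms(3)] S(2,5))
qed

lemma hub_cong:
  assumes "hub i \<rho> X U par rk" "\<And>y. y \<in> U \<Longrightarrow> par' y = par y \<and> rk' y = rk y" "i' \<le> i"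
  shows "hub i' \<rho> X U par' rk'"
proof -
  note A = arborD[OF hubD(1)[OF assms(1)]]
  have "covers U \<rho> par' rk' v a b (64 * k * log 2 (card X) * (l b - l a))"
    if "a \<le> b" "paced h G v l a b" "v ` {a..b} \<subseteq> X" for v l a b
    by (rule covers_cong[OF hubD(3)[OF assms(1) that]]) (simp_all add: assms(2))
  moreover have "par' y \<in> insert \<rho> U \<and> i' < rk' y \<and> rk' y \<le> L \<and> (par' y \<in> U \<longrightarrow> rk' (par' y) < rk' y) \<and>
        (1 < rk' y \<longrightarrow> near G \<beta> (D (rk' y - 1)) (fst y) (fst (par' y)))" if "y \<in> U" for y
    using A(3-7)[OF that] assms(2)[OF that] assms(2)[of "par y"] assms(3) by auto
  ultimately show ?thesis unfolding hub_def arbor_def using A(1,2) hubD(2)[OF assms(1)] by blast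
qed

text \<open>Ranks decrease towards \<open>\<rho>\<close>, so each level from \<open>i\<close> on
  contributes at most one edge and the weights form a geometric sum.\<close>

lemma path_to_root:
  assumes "arbor i \<rho> U par rk" "y \<in> insert \<rho> U"
  obtains S where "S \<subseteq> insert \<rho> U" "\<rho> \<in> S" "y \<in> S" "\<forall>x\<in>S - {\<rho>}. par x \<in> S"
    "(\<Sum>x\<in>S - {\<rho>}. D (rk x - 1)) \<le> 2 * D i"
proof -
  note A = arborD[OF assms(1)]
  \<comment> \<open>The term \<open>2 * D (rk y)\<close> is the room left for extending the path
    below \<open>y\<close>.\<close>
  have main: "\<exists>S. S \<subseteq> insert \<rho> U \<and> \<rho> \<in> S \<and> y \<in> S \<and> (\<forall>x\<in>S - {\<rho>}. par x \<in> S) \<and>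
    (\<Sum>x\<in>S - {\<rho>}. D (rk x - 1)) + 2 * D (rk y) \<le> 2 * D i" if "y \<in> U" for y
    using that
  proof (induction "rk y" arbitrary: y rule: less_induct)
    case less
    note y = less.prems
    have ry: "0 < rk y" "i \<le> rk y - 1" using A(4)[OF y] by auto
    have le: "D (rk y - 1) + 2 * D (rk y) \<le> 2 * D (rk y - 1)"
      using D[of "rk y - 1"] ry by (simp add: mult_2 add_mono)
    show ?case
    proof (cases "par y = \<rho>")
      case True
      have "{\<rho>, y} - {\<rho>} = {y}" using A(2) y by auto
      moreover have "2 * D (rk y - 1) \<le> 2 * D i" using D_antimono[OF ry(2)] by (rule mult_left_mono) simp
      ultimately show ?thesis using y le True
        by (intro exI[of _ "{\<rho>, y}"]) auto
    next
      case False
      then have py: "par y \<in> U" using A(3)[OF y] by auto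
      obtain S where S: "S \<subseteq> insert \<rho> U" "\<rho> \<in> S" "par y \<in> S" "\<forall>x\<in>S - {\<rho>}. par x \<in> S"
        "(\<Sum>x\<in>S - {\<rho>}. D (rk x - 1)) + 2 * D (rk (par y)) \<le> 2 * D i"
        using less.hyps[OF A(6)[OF y py] py] by blast
      have finS: "finite S" using S(1) A(1) finite_subset by blast
      have "(\<Sum>x\<in>insert y S - {\<rho>}. D (rk x - 1)) \<le> D (rk y - 1) + (\<Sum>x\<in>S - {\<rho>}. D (rk x - 1))"
      proof -
        have "insert y S - {\<rho>} = insert y (S - {\<rho>})" using A(2) y by auto
        then show ?thesis using finS by (cases "y \<in> S") (auto simp: insert_absorb)
      qed
      then have "(\<Sum>x\<in>insert y S - {\<rho>}. D (rk x - 1)) + 2 * D (rk y)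
          \<le> (\<Sum>x\<in>S - {\<rho>}. D (rk x - 1)) + (D (rk y - 1) + 2 * D (rk y))"
        by (simp add: add.assoc add.left_commute add_right_mono)
      also have "\<dots> \<le> (\<Sum>x\<in>S - {\<rho>}. D (rk x - 1)) + 2 * D (rk (par y))"
      proof (rule add_left_mono)
        have "D (rk y - 1) \<le> D (rk (par y))" using A(6)[OF y py] by (intro D_antimono) simp
        then have "2 * D (rk y - 1) \<le> 2 * D (rk (par y))" by (rule mult_left_mono) simp
        with le show "D (rk y - 1) + 2 * D (rk y) \<le> 2 * D (rk (par y))" by (rule order_trans)
      qed
      finally have "(\<Sum>x\<in>insert y S - {\<rho>}. D (rk x - 1)) + 2 * D (rk y) \<le> 2 * D i"
        using S(5) by (rule order_trans)
      then show ?thesis using S y by (intro exI[of _ "insert y S"]) auto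
    qed
  qed
  have "\<exists>S. S \<subseteq> insert \<rho> U \<and> \<rho> \<in> S \<and> y \<in> S \<and> (\<forall>x\<in>S - {\<rho>}. par x \<in> S) \<and>
    (\<Sum>x\<in>S - {\<rho>}. D (rk x - 1)) \<le> 2 * D i"
  proof (cases "y = \<rho>")
    case True
    then show ?thesis by (intro exI[of _ "{\<rho>}"]) auto
  next
    case False
    then have "y \<in> U" using assms(2) by simp
    from main[OF this] obtain S where S: "S \<subseteq> insert \<rho> U" "\<rho> \<in> S" "y \<in> S" "\<forall>x\<in>S - {\<rho>}. par x \<in> S"
        "(\<Sum>x\<in>S - {\<rho>}. D (rk x - 1)) + 2 * D (rk y) \<le> 2 * D i" by blast
    have "(\<Sum>x\<in>S - {\<rho>}. D (rk x - 1)) \<le> (\<Sum>x\<in>S - {\<rho>}. D (rk x - 1)) + 2 * D (rk y)" by simp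
    with S(5) have "(\<Sum>x\<in>S - {\<rho>}. D (rk x - 1)) \<le> 2 * D i" by (rule order_trans[rotated])
    with S show ?thesis by blast
  qed
  then show ?thesis using that by blast
qed

text \<open>Both tops are linked to \<open>\<rho>\<close>, at a price of at most
  \<open>2 * D i\<close> each, and \<open>\<rho>\<close> becomes the top of the union.\<close>

lemma covers_join:
  assumes A: "arbor i \<rho> U par rk"
    and c1: "covers U \<rho> par rk v a b c" and c2: "covers U \<rho> par rk v (Suc b) d c'"
    and c: "0 \<le> c" "0 \<le> c'" "0 \<le> m" and m: "4 * D i \<le> ennreal m"
  shows "covers U \<rho> par rk v a d (c + c' + m)"
proof -
  let ?w = "\<lambda>S t. \<Sum>y\<in>S - {t}. D (rk y - 1)"
  obtain S1 t1 where 1: "S1 \<subseteq> insert \<rho> U" "t1 \<in> S1" "\<forall>y\<in>S1 - {t1}. y \<in> U \<and> par y \<in> S1"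
    "?w S1 t1 \<le> ennreal c" "\<forall>i\<in>{a..b}. \<exists>y\<in>S1. fst y = v i"
    using c1 unfolding covers_def by blast
  obtain S2 t2 where 2: "S2 \<subseteq> insert \<rho> U" "t2 \<in> S2" "\<forall>y\<in>S2 - {t2}. y \<in> U \<and> par y \<in> S2"
    "?w S2 t2 \<le> ennreal c'" "\<forall>i\<in>{Suc b..d}. \<exists>y\<in>S2. fst y = v i"
    using c2 unfolding covers_def by blast
  have t12: "t1 \<in> insert \<rho> U" "t2 \<in> insert \<rho> U" using 1 2 by auto
  obtain P1 where P1: "P1 \<subseteq> insert \<rho> U" "\<rho> \<in> P1" "t1 \<in> P1" "\<forall>x\<in>P1 - {\<rho>}. par x \<in> P1" "?w P1 \<rho> \<le> 2 * D i"
    using path_to_root[OF A t12(1)] by metis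
  obtain P2 where P2: "P2 \<subseteq> insert \<rho> U" "\<rho> \<in> P2" "t2 \<in> P2" "\<forall>x\<in>P2 - {\<rho>}. par x \<in> P2" "?w P2 \<rho> \<le> 2 * D i"
    using path_to_root[OF A t12(2)] by metis
  define S where "S = S1 \<union> S2 \<union> (P1 \<union> P2)"
  have fin: "finite S1" "finite S2" "finite P1" "finite P2"
    using 1(1) 2(1) P1(1) P2(1) arborD(1)[OF A] finite_subset finite_insert by metis+
  have le: "sum g (V \<union> W) \<le> sum g V + sum g W" if "finite V" "finite W" for V W and g :: "'a \<times> nat \<Rightarrow> ennreal"
    using that by (metis sum.union_inter le_iff_add)
  have "?w S \<rho> \<le> (\<Sum>y\<in>(S1 - {t1}) \<union> (S2 - {t2}) \<union> ((P1 - {\<rho>}) \<union> (P2 - {\<rho>})). D (rk y - 1))"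
    using P1 P2 fin by (intro sum_mono2) (auto simp: S_def)
  also have "\<dots> \<le> (?w S1 t1 + ?w S2 t2) + (?w P1 \<rho> + ?w P2 \<rho>)"
    using fin by (intro le[THEN order_trans] add_mono) auto
  also have "\<dots> \<le> (ennreal c + ennreal c') + (2 * D i + 2 * D i)"
    by (intro add_mono 1 2 P1 P2)
  also have "2 * D i + 2 * D i = 4 * D i"
    by (simp flip: distrib_right)
  also have "(ennreal c + ennreal c') + 4 * D i \<le> ennreal (c + c' + m)"
    using m c by (simp add: add_left_mono)
  finally have w: "?w S \<rho> \<le> ennreal (c + c' + m)" .
  have "S \<subseteq> insert \<rho> U" "\<rho> \<in> S" using 1(1) 2(1) P1 P2 by (auto simp: S_def)
  have cl: "y \<in> U \<and> par y \<in> S" if y: "y \<in> S - {\<rho>}" for y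
  proof
    show "y \<in> U" using y \<open>S \<subseteq> insert \<rho> U\<close> by auto
    consider "y \<in> S1 - {t1}" | "y \<in> S2 - {t2}" | "y \<in> P1 - {\<rho>}" | "y \<in> P2 - {\<rho>}"
      using y P1(3) P2(3) unfolding S_def by auto
    then show "par y \<in> S"
      unfolding S_def using 1(3) 2(3) P1(4) P2(4) by cases auto
  qed
  have cov: "\<exists>y\<in>S. fst y = v i" if "i \<in> {a..d}" for i
    
  proof (cases "i \<le> b")
    case True
    then have "\<exists>y\<in>S1. fst y = v i" using that by (intro 1(5)[rule_format]) auto
    then show ?thesis unfolding S_def by blast
  next
    case False
    then have "\<exists>y\<in>S2. fst y = v i" using that by (intro 2(5)[rule_format]) auto
    then show ?thesis unfolding S_def by blast
  qed
  show ?thesis unfolding covers_def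
    by (intro exI[of _ S] exI[of _ \<rho>] conjI ballI w cl cov) fact+
qed

section \<open>Separated pieces and the union of their trees\<close>

lemma log_card_mono: "A \<subseteq> B \<Longrightarrow> finite B \<Longrightarrow> log 2 (real (card A)) \<le> log 2 (real (card B))"
  "0 \<le> log 2 (real (card A))"
proof -
  \<comment> \<open>The value of \<open>log 2 0\<close> is 0, so the empty set is no
    exception.\<close>
  show *: "0 \<le> log 2 (real (card A))" for A :: "'b set"
    by (cases "card A = 0") (auto simp: log_def)
  assume "A \<subseteq> B" "finite B"
  then show "log 2 (real (card A)) \<le> log 2 (real (card B))"
    using *[of B] card_mono[of B A] by (cases "card A = 0") (auto simp: log_def divide_right_mono)
qed

text \<open>The cost \<open>4 * D i\<close> of a cut is covered by the difference of the rates for \<open>Y \<union> Z\<close> and for \<open>Y\<close>.\<close>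
definition separated :: "nat \<Rightarrow> 'a set \<Rightarrow> 'a set \<Rightarrow> bool" where
  "separated i Y Z \<longleftrightarrow> (\<forall>u\<in>Y - Z. \<forall>u'\<in>Z - Y. \<forall>d. hop_dist h G u u' \<le> ennreal d \<longrightarrow>
     4 * D i \<le> ennreal (64 * k * (log 2 (card (Y \<union> Z)) - log 2 (card Y)) * d))"

text \<open>An instance of \<open>interval_cover\<close>: \<open>covers_join\<close> sets the price
  \<open>4 * D i\<close> of a join, and \<open>separated\<close> yields the premise on
  crossings.\<close>

lemma hub_union:
  assumes Y: "hub i \<rho> Y U par rk" and Z: "hub i \<rho> Z W par rk"
    and fin: "finite (Y \<union> Z)" and sep: "separated i Y Z"
  shows "hub i \<rho> (Y \<union> Z) (U \<union> W) par rk"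
proof -
  note AY = arborD[OF hubD(1)[OF Y]] and AZ = arborD[OF hubD(1)[OF Z]]
  have A: "arbor i \<rho> (U \<union> W) par rk"
    unfolding arbor_def using AY AZ by (metis UnE UnI1 UnI2 finite_Un insert_iff)
  let ?K = "\<lambda>X :: 'a set. 64 * real k * log 2 (card X)"
  have "covers (U \<union> W) \<rho> par rk v lo hi (?K (Y \<union> Z) * (l hi - l lo))"
    if ab: "lo \<le> hi" "paced h G v l lo hi" "v ` {lo..hi} \<subseteq> Y \<union> Z" for v l lo hi
  proof (rule interval_cover[where lo = lo and hi = hi and M = "4 * D i" and Y = Y and Z = Z and v = v
        and KY = "?K Y" and KZ = "?K Z"])
    fix a b c c' assume "covers (U \<union> W) \<rho> par rk v a b c" "c \<le> c'"
    then show "covers (U \<union> W) \<rho> par rk v a b c'" using covers_cong by blast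
  next
    fix a b d c c' m
    assume "covers (U \<union> W) \<rho> par rk v a b c" "covers (U \<union> W) \<rho> par rk v (Suc b) d c'"
      "0 \<le> c" "0 \<le> c'" "0 \<le> m" "4 * D i \<le> ennreal m"
    then show "covers (U \<union> W) \<rho> par rk v a d (c + c' + m)" by (rule covers_join[OF A])
  next
    fix a b assume 1: "lo \<le> a" "a \<le> b" "b \<le> hi"
    note p = paced_mono[OF ab(2) 1(1,3)]
    show "covers (U \<union> W) \<rho> par rk v a b (?K Y * (l b - l a))" if "v ` {a..b} \<subseteq> Y"
      by (rule covers_cong[OF hubD(3)[OF Y 1(2) p that]]) auto
    show "covers (U \<union> W) \<rho> par rk v a b (?K Z * (l b - l a))" if "v ` {a..b} \<subseteq> Z"
      by (rule covers_cong[OF hubD(3)[OF Z 1(2) p that]]) auto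
  next
    show "0 \<le> ?K Y" "0 \<le> ?K Z" by (simp_all add: log_card_mono(2))
    show "?K Y \<le> ?K (Y \<union> Z)" "?K Z \<le> ?K (Y \<union> Z)"
      using log_card_mono(1)[OF _ fin] by (simp_all add: mult_left_mono)
  next
    fix i' j assume ij: "lo \<le> i'" "i' \<le> j" "j \<le> hi"
    with ab(2) show "l i' \<le> l j" unfolding paced_def by blast
    assume c: "v i' \<notin> Z \<and> v j \<notin> Y \<or> v i' \<notin> Y \<and> v j \<notin> Z"
    have "v i' \<in> v ` {lo..hi}" "v j \<in> v ` {lo..hi}" using ij by (auto intro!: imageI)
    with ab(3) have "v i' \<in> Y \<union> Z" "v j \<in> Y \<union> Z" by blast+
    then consider "v i' \<in> Y - Z" "v j \<in> Z - Y" | "v j \<in> Y - Z" "v i' \<in> Z - Y" using c by blast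
    moreover have "hop_dist h G (v i') (v j) \<le> ennreal (l j - l i')" using ab(2) ij unfolding paced_def by blast
    ultimately have "4 * D i \<le> ennreal (64 * k * (log 2 (card (Y \<union> Z)) - log 2 (card Y)) * (l j - l i'))"
      using sep unfolding separated_def by cases (auto simp: hop_dist_sym[of h G "v i'" "v j"])
    then show "4 * D i \<le> ennreal ((?K (Y \<union> Z) - ?K Y) * (l j - l i'))" by (simp add: algebra_simps)
  qed (use ab in auto)
  moreover have "fst ` (U \<union> W) \<subseteq> Y \<union> Z" using hubD(2)[OF Y] hubD(2)[OF Z] by auto
  ultimately show ?thesis unfolding hub_def using A by simp
qed

text \<open>The old root \<open>\<sigma>\<close> becomes an ordinary vertex of rank
  \<open>Suc i\<close>, so the new edge weighs \<open>D i\<close>, the radius of the cluster in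
  which it is made. For \<open>i = 0\<close> this edge will be infinite, hence the restriction on
  \<open>near\<close>.\<close>

lemma hub_attach:
  assumes H: "hub (Suc i) \<sigma> X U par rk" and \<rho>: "\<rho> \<notin> insert \<sigma> U" and iL: "i < L" and \<sigma>: "fst \<sigma> \<in> X"
    and near: "0 < i \<Longrightarrow> near G \<beta> (D i) (fst \<sigma>) (fst \<rho>)"
  shows "hub i \<rho> X (insert \<sigma> U) (par(\<sigma> := \<rho>)) (rk(\<sigma> := Suc i))"
proof -
  note A = arborD[OF hubD(1)[OF H]]
  let ?par = "par(\<sigma> := \<rho>)" and ?rk = "rk(\<sigma> := Suc i)"
  have "?par y \<in> insert \<rho> (insert \<sigma> U) \<and> i < ?rk y \<and> ?rk y \<le> L \<and> (?par y \<in> insert \<sigma> U \<longrightarrow> ?rk (?par y) < ?rk y) \<and>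
        (1 < ?rk y \<longrightarrow> near G \<beta> (D (?rk y - 1)) (fst y) (fst (?par y)))" if "y \<in> insert \<sigma> U" for y
  proof (cases "y = \<sigma>")
    case True
    then show ?thesis using \<rho> near iL by auto
  next
    case False
    then have y: "y \<in> U" using that by simp
    then have "y \<noteq> \<rho>" using \<rho> by auto
    then show ?thesis using A(2) A(3-7)[OF y] False by auto
  qed
  moreover have "covers (insert \<sigma> U) \<rho> ?par ?rk v a b (64 * k * log 2 (card X) * (l b - l a))"
    if "a \<le> b" "paced h G v l a b" "v ` {a..b} \<subseteq> X" for v l a b
    by (rule covers_cong[OF hubD(3)[OF H that]]) (use A(2) in auto)
  moreover have "fst ` insert \<sigma> U \<subseteq> X" using \<sigma> hubD(2)[OF H] by auto
  ultimately show ?thesis unfolding hub_def arbor_def using A(1) \<rho> by simp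
qed

lemma hub_disjoint_union:
  assumes Y: "hub i \<rho> Y U par rk" and Z: "hub i \<rho> Z W par' rk'" and disj: "U \<inter> W = {}"
    and fin: "finite (Y \<union> Z)" and sep: "separated i Y Z \<or> separated i Z Y"
  shows "\<exists>par rk. hub i \<rho> (Y \<union> Z) (U \<union> W) par rk"
proof -
  let ?par = "\<lambda>y. if y \<in> U then par y else par' y" and ?rk = "\<lambda>y. if y \<in> U then rk y else rk' y"
  have Y': "hub i \<rho> Y U ?par ?rk" by (rule hub_cong[OF Y]) auto
  have Z': "hub i \<rho> Z W ?par ?rk" by (rule hub_cong[OF Z]) (use disj in auto)
  from sep show ?thesis
  proof
    assume "separated i Y Z"
    from hub_union[OF Y' Z' fin this] show ?thesis by blast
  next
    assume "separated i Z Y"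
    with hub_union[OF Z' Y'] fin show ?thesis by (metis Un_commute)
  qed
qed

text \<open>The two points lie on opposite sides of the layer, so their \<open>h\<close>-hop
  distance is at least \<open>D i * s / (8 * k)\<close>. Times the rate difference
  \<open>64 * k * ?g\<close> this is \<open>8 * s * ?g * D i\<close>, and
  \<open>1 \<le> 2 * s * ?g\<close> makes it at least \<open>4 * D i\<close>.\<close>

lemma separatedI:
  assumes A: "A \<subseteq> A'" "A' \<subseteq> X" and s: "0 < s" "1 \<le> 2 * s * (log 2 (card X) - log 2 (card Y))"
    and YZ: "Y = A' \<and> Z = X - A \<or> Y = X - A \<and> Z = A'"
    and far: "\<And>a u. a \<in> A \<Longrightarrow> u \<in> X - A' \<Longrightarrow> \<not> near G h (D i * ennreal (s / (8 * k))) a u"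
  shows "separated i Y Z"
  unfolding separated_def
proof (intro ballI allI impI)
  fix u u' d assume u: "u \<in> Y - Z" "u' \<in> Z - Y" and d: "hop_dist h G u u' \<le> ennreal d"
  let ?g = "log 2 (card X) - log 2 (card Y)"
  have X: "Y \<union> Z = X" using YZ A by blast
  have "u \<in> A \<and> u' \<in> X - A' \<or> u' \<in> A \<and> u \<in> X - A'"
    using YZ
  proof (elim disjE conjE)
    assume "Y = A'" "Z = X - A"
    with u A have "u \<in> A" "u' \<in> X" "u' \<notin> A'" by blast+
    then show ?thesis by blast
  next
    assume "Y = X - A" "Z = A'"
    with u A have "u \<in> X" "u \<notin> A'" "u' \<in> A" by blast+
    then show ?thesis by blast
  qed
  then have "\<not> near G h (D i * ennreal (s / (8 * k))) u u'"
  proof (elim disjE conjE)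
    assume "u' \<in> A" "u \<in> X - A'"
    from far[OF this] show ?thesis by (metis near_sym)
  qed (rule far)
  then have le: "D i * ennreal (s / (8 * k)) \<le> ennreal d"
    using near_if_hop_dist_less[of h G u u'] d by (meson linorder_not_le order_trans)
  have "0 < 2 * s * ?g" using s by linarith
  then have g: "0 < ?g" using s by (simp add: zero_less_mult_iff)
  have "4 * D i = D i * ennreal 4" by (simp add: mult.commute)
  also have "\<dots> \<le> D i * ennreal (s / (8 * k) * (64 * k * ?g))"
  proof (intro mult_left_mono ennreal_leI)
    have "s / (8 * k) * (64 * k * ?g) = 4 * (2 * s * ?g)" using k by (simp add: field_simps)
    then show "4 \<le> s / (8 * k) * (64 * k * ?g)" using s(2) by linarith
  qed simp
  also have "\<dots> = D i * ennreal (s / (8 * k)) * ennreal (64 * k * ?g)"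
    using s g by (subst ennreal_mult) (auto simp: mult.assoc)
  also have "\<dots> \<le> ennreal d * ennreal (64 * k * ?g)"
    using le by (rule mult_right_mono) simp
  also have "\<dots> = ennreal (64 * k * ?g * d)"
    using g by (subst ennreal_mult'[of "64 * k * ?g"]) (auto simp: mult.commute)
  finally show "4 * D i \<le> ennreal (64 * k * (log 2 (card (Y \<union> Z)) - log 2 (card Y)) * d)"
    by (simp add: X)
qed

section \<open>Growing clusters and building the tree level by level\<close>

lemma cluster:
  assumes i: "i < L" and X: "X \<subseteq> verts G" "v \<in> X"
  obtains A A' where "v \<in> A" "A \<subseteq> A'" "A' \<subseteq> X" "\<And>u. u \<in> A' \<Longrightarrow> near G \<beta> (D (Suc i)) v u"
    "card A' powr (1 + 1 / k) + card (X - A) powr (1 + 1 / k) \<le> card X powr (1 + 1 / k)"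
    "separated i A' (X - A) \<or> separated i (X - A) A'"
proof -
  let ?n = "card (verts G)"
  \<comment> \<open>Widths are measured in units of \<open>D i / (8 * k)\<close>, so a total of at
    most \<open>4 * k\<close> stays within \<open>D i / 2\<close>. Each growth step spends
    \<open>h\<close> hops and satisfies \<open>1 \<le> s * log 2 n\<close>, so
    \<open>t * log 2 n\<close> bounds the number of steps. The walks may leave
    \<open>X\<close>.\<close>
  let ?w = "\<lambda>t. D i * ennreal (t / (8 * k))"
  let ?E = "\<lambda>s A. {u \<in> X. \<exists>a\<in>A. near G h (?w s) a u}"
  let ?R = "\<lambda>t A. \<forall>u\<in>A. \<exists>j. real j \<le> t * log 2 ?n \<and> near G (j * h) (?w t) v u"
  have hE: "A \<subseteq> ?E s A \<and> ?E s A \<subseteq> X" if "A \<subseteq> X" for A s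
    using that X by (auto intro: near_refl)
  have hR0: "?R 0 {v}" using near_refl[of v G] X by (auto intro!: exI[of _ 0])
  have hR: "?R (t + s) (?E s A)" if R: "?R t A" and ts: "0 \<le> t" "0 < s" "1 \<le> s * log 2 ?n" for t s A
  proof
    fix u assume "u \<in> ?E s A"
    then obtain a where a: "a \<in> A" "near G h (?w s) a u" by blast
    then obtain j where j: "real j \<le> t * log 2 ?n" "near G (j * h) (?w t) v a" using R by blast
    have "?w t + ?w s = ?w (t + s)"
      using ts by (simp add: distrib_left[symmetric] ennreal_plus[symmetric] add_divide_distrib del: ennreal_plus)
    then have "near G (Suc j * h) (?w (t + s)) v u"
      using near_trans[OF j(2) a(2)] by (simp add: add.commute)
    moreover have "real (Suc j) \<le> (t + s) * log 2 ?n" using j(1) ts(3) by (simp add: distrib_right)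
    ultimately show "\<exists>j. real j \<le> (t + s) * log 2 ?n \<and> near G (j * h) (?w (t + s)) v u" by blast
  qed
  have finX: "finite X" and cX: "card X \<le> ?n" using X fin by (auto simp: card_mono intro: finite_subset)
  have k1: "1 \<le> real k" using k by simp
  obtain A A' t s where A: "v \<in> A" "A \<subseteq> A'" "A' \<subseteq> X" "?R t A'" "0 \<le> t" "t \<le> 4 * real k"
    "card A' powr (1 + 1 / k) + card (X - A) powr (1 + 1 / k) \<le> card X powr (1 + 1 / k)"
    and c: "A' = X \<and> A = X \<or> A' = ?E s A \<and> 0 < s \<and> A' \<noteq> X \<and> (\<exists>Y\<in>{A', X - A}. 1 \<le> 2 * s * (log 2 (card X) - log 2 (card Y)))"
    by (rule growing_cluster[OF finX X(2) cX k1, where E = ?E and R = ?R]) (assumption | rule hE hR0 hR)+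
  have "near G \<beta> (D (Suc i)) v u" if u: "u \<in> A'" for u
  proof -
    obtain j where j: "real j \<le> t * log 2 ?n" "near G (j * h) (?w t) v u" using A(4) u by blast
    have "t * log 2 ?n \<le> 4 * real k * log 2 ?n" using A(6) log_card_mono(2) by (rule mult_right_mono)
    with j(1) have "j * h \<le> \<beta>" by (intro hops) simp
    moreover have "?w t \<le> D i * ennreal (1 / 2)"
      using A(5,6) k by (intro mult_left_mono ennreal_leI) (auto simp: field_simps)
    ultimately have "near G \<beta> (D i * ennreal (1 / 2)) v u" by (rule near_mono[OF j(2)])
    then show ?thesis by (rule shrink[OF i])
  qed
  moreover have "separated i A' (X - A) \<or> separated i (X - A) A'"
  proof (cases "A' = X \<and> A = X")
    case True
    then show ?thesis by (simp add: separated_def)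
  next
    case False
    then have c': "A' = ?E s A" "0 < s" "\<exists>Y\<in>{A', X - A}. 1 \<le> 2 * s * (log 2 (card X) - log 2 (card Y))"
      using c by blast+
    have far: "\<not> near G h (?w s) a u" if "a \<in> A" "u \<in> X - A'" for a u
      using that unfolding c'(1) by blast
    from c'(3) show ?thesis
    proof
      fix Y assume Y: "Y \<in> {A', X - A}" "1 \<le> 2 * s * (log 2 (card X) - log 2 (card Y))"
      then have "Y = A' \<or> Y = X - A" by simp
      then show ?thesis using separatedI[OF A(2,3) c'(2) Y(2) _ far] by metis
    qed
  qed
  ultimately show ?thesis by (intro that[OF A(1-3) _ A(7)])
qed

text \<open>The label \<open>m\<close> keeps copies apart: all copies below the root have larger
  labels. The summand 1 counts the root \<open>(x, m)\<close>, which is not in \<open>U\<close>. If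
  \<open>r\<close> lies in \<open>X\<close>, it is the root and gets no further copy.\<close>

definition buildable :: "nat \<Rightarrow> bool" where
  "buildable i \<longleftrightarrow> (\<forall>X x m. X \<subseteq> verts G \<and> x \<in> X \<and> (r \<in> X \<longrightarrow> x = r) \<and> (0 < i \<longrightarrow> (\<forall>u\<in>X. near G \<beta> (D i) x u)) \<longrightarrow>
     (\<exists>U par rk. hub i (x, m) X U par rk \<and> (\<forall>y\<in>U. m < snd y) \<and> r \<notin> fst ` U \<and>
        real (card U) + 1 \<le> card X powr (1 + 1 / k)))"

lemma label_bound:
  assumes "finite (U :: ('a \<times> nat) set)"
  obtains m' where "m \<le> m'" "\<And>y. y \<in> U \<Longrightarrow> snd y \<le> m'"
proof -
  have "finite (insert m (snd ` U))" using assms by simp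
  then show ?thesis using that[of "Max (insert m (snd ` U))"] by (meson Max_ge image_eqI insertCI)
qed

text \<open>Clusters are cut off one after the other and their roots attached to the given
  \<open>\<rho>\<close>. These roots belong to \<open>U\<close>, so the bound has no summand 1. The
  remaining part gets labels above those of the cluster just built, which keeps the copies
  disjoint.\<close>

lemma build_forest:
  assumes i: "i < L" and B: "buildable (Suc i)"
  shows "X \<subseteq> verts G \<Longrightarrow> r \<notin> X \<Longrightarrow> snd \<rho> \<le> m \<Longrightarrow> (0 < i \<Longrightarrow> \<forall>u\<in>X. near G \<beta> (D i) u (fst \<rho>)) \<Longrightarrow>
    \<exists>U par rk. hub i \<rho> X U par rk \<and> (\<forall>y\<in>U. m < snd y) \<and> real (card U) \<le> card X powr (1 + 1 / k)"
proof (induction "card X" arbitrary: X m rule: less_induct)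
  case less
  have finX: "finite X" using less.prems fin finite_subset by blast
  show ?case
  proof (cases "X = {}")
    case True
    then have "hub i \<rho> X {} undefined undefined" by (auto simp: hub_def arbor_def)
    then show ?thesis by (intro exI) auto
  next
    case False
    then obtain v where v: "v \<in> X" by blast
    obtain A A' where A: "v \<in> A" "A \<subseteq> A'" "A' \<subseteq> X" "\<And>u. u \<in> A' \<Longrightarrow> near G \<beta> (D (Suc i)) v u"
      "card A' powr (1 + 1 / k) + card (X - A) powr (1 + 1 / k) \<le> card X powr (1 + 1 / k)"
      "separated i A' (X - A) \<or> separated i (X - A) A'"
      using cluster[OF i less.prems(1) v] by blast
    have "A' \<subseteq> verts G" "v \<in> A'" "r \<notin> A'" using A less.prems by auto
    then obtain U par rk where U: "hub (Suc i) (v, Suc m) A' U par rk" "\<forall>y\<in>U. Suc m < snd y"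
      "real (card U) + 1 \<le> card A' powr (1 + 1 / k)"
      using B[unfolded buildable_def, rule_format, of A' v "Suc m"] A(4) by blast
    note AU = arborD[OF hubD(1)[OF U(1)]]
    have \<rho>: "\<rho> \<notin> insert (v, Suc m) U" using less.prems(3) U(2) by auto
    have 1: "hub i \<rho> A' (insert (v, Suc m) U) (par((v, Suc m) := \<rho>)) (rk((v, Suc m) := Suc i))"
      using less.prems(4) v A by (intro hub_attach[OF U(1) \<rho> i]) auto
    obtain m' where m': "Suc m \<le> m'" "\<And>y. y \<in> U \<Longrightarrow> snd y \<le> m'" using label_bound[OF AU(1)] by metis
    have "card (X - A) < card X" using v A(1) finX by (intro psubset_card_mono) auto
    then have "\<exists>W par' rk'. hub i \<rho> (X - A) W par' rk' \<and> (\<forall>y\<in>W. m' < snd y) \<and>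
        real (card W) \<le> card (X - A) powr (1 + 1 / k)"
      by (rule less.hyps) (use less.prems m'(1) in auto)
    then obtain W par' rk' where W: "hub i \<rho> (X - A) W par' rk'" "\<forall>y\<in>W. m' < snd y"
      "real (card W) \<le> card (X - A) powr (1 + 1 / k)"
      by blast
    have disj: "insert (v, Suc m) U \<inter> W = {}" using m' W(2) by fastforce
    have X: "A' \<union> (X - A) = X" using A by auto
    obtain par2 rk2 where H: "hub i \<rho> X (insert (v, Suc m) U \<union> W) par2 rk2"
      using hub_disjoint_union[OF 1 W(1) disj _ A(6)] finX unfolding X by blast
    have "real (card (insert (v, Suc m) U \<union> W)) \<le> real (card U + 1 + card W)"
      using card_Un_le[of "insert (v, Suc m) U" W] AU(1,2) by simp
    also have "\<dots> \<le> card X powr (1 + 1 / k)" using U(3) W(3) A(5) by simp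
    finally have "real (card (insert (v, Suc m) U \<union> W)) \<le> card X powr (1 + 1 / k)" .
    moreover have "\<forall>y\<in>insert (v, Suc m) U \<union> W. m < snd y" using U(2) W(2) m'(1) by fastforce
    ultimately show ?thesis using H by blast
  qed
qed

text \<open>The first cluster is grown around \<open>x\<close> and keeps \<open>(x, m)\<close> as
  its root without a new edge; the rest becomes a forest below it. If \<open>r\<close> is in
  \<open>X\<close>, then \<open>x = r\<close> lies in \<open>A\<close>, so the rest avoids
  \<open>r\<close>.\<close>

lemma buildable_step:
  assumes i: "i < L" and B: "buildable (Suc i)"
  shows "buildable i"
  unfolding buildable_def
proof (intro allI impI, elim conjE)
  fix X x m
  assume X: "X \<subseteq> verts G" "x \<in> X" "r \<in> X \<longrightarrow> x = r" "0 < i \<longrightarrow> (\<forall>u\<in>X. near G \<beta> (D i) x u)"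
  have finX: "finite X" using X fin finite_subset by blast
  obtain A A' where A: "x \<in> A" "A \<subseteq> A'" "A' \<subseteq> X" "\<And>u. u \<in> A' \<Longrightarrow> near G \<beta> (D (Suc i)) x u"
      "card A' powr (1 + 1 / k) + card (X - A) powr (1 + 1 / k) \<le> card X powr (1 + 1 / k)"
      "separated i A' (X - A) \<or> separated i (X - A) A'"
    using cluster[OF i X(1,2)] by blast
  have "A' \<subseteq> verts G" "x \<in> A'" "r \<in> A' \<longrightarrow> x = r" using A X by auto
  then obtain U par rk where U: "hub (Suc i) (x, m) A' U par rk" "\<forall>y\<in>U. m < snd y" "r \<notin> fst ` U"
      "real (card U) + 1 \<le> card A' powr (1 + 1 / k)"
    using B[unfolded buildable_def, rule_format, of A' x m] A(4) by blast
  have 1: "hub i (x, m) A' U par rk" by (rule hub_cong[OF U(1)]) auto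
  obtain m' where m': "m \<le> m'" "\<And>y. y \<in> U \<Longrightarrow> snd y \<le> m'"
    using label_bound[OF arborD(1)[OF hubD(1)[OF 1]]] by metis
  have rXA: "r \<notin> X - A" using X(3) A(1) by auto
  have near': "\<forall>u\<in>X - A. near G \<beta> (D i) u (fst (x, m))" if "0 < i"
    using X(4) that near_sym by (metis DiffD1 fst_conv)
  have "X - A \<subseteq> verts G" "snd (x, m) \<le> m'" using X(1) m'(1) by auto
  from build_forest[OF i B this(1) rXA this(2) near'] obtain W par' rk' where W: "hub i (x, m) (X - A) W par' rk'" "\<forall>y\<in>W. m' < snd y"
      "real (card W) \<le> card (X - A) powr (1 + 1 / k)"
    by blast
  have disj: "U \<inter> W = {}" using m' W(2) by fastforce
  have X': "A' \<union> (X - A) = X" using A by auto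
  obtain par2 rk2 where H: "hub i (x, m) X (U \<union> W) par2 rk2"
    using hub_disjoint_union[OF 1 W(1) disj _ A(6)] finX unfolding X' by blast
  have "real (card (U \<union> W)) + 1 \<le> real (card U + card W) + 1"
    using card_Un_le[of U W] by simp
  also have "\<dots> \<le> card X powr (1 + 1 / k)" using U(4) W(3) A(5) by simp
  finally have "real (card (U \<union> W)) + 1 \<le> card X powr (1 + 1 / k)" .
  moreover have "\<forall>y\<in>U \<union> W. m < snd y" using U(2) W(2) m'(1) by fastforce
  moreover have "r \<notin> fst ` (U \<union> W)" using U(3) hubD(2)[OF W(1)] rXA by auto
  ultimately show "\<exists>U par rk. hub i (x, m) X U par rk \<and> (\<forall>y\<in>U. m < snd y) \<and> r \<notin> fst ` U \<and>
        real (card U) + 1 \<le> card X powr (1 + 1 / k)"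
    using H by blast
qed

text \<open>By \<open>bottom\<close> only the root is left; it covers a constant sequence at cost 0,
  in agreement with \<open>log 2 1 = 0\<close>.\<close>

lemma buildable_bottom: "buildable L"
  unfolding buildable_def
proof (intro allI impI, elim conjE)
  fix X x m
  assume X: "X \<subseteq> verts G" "x \<in> X" "r \<in> X \<longrightarrow> x = r" "0 < L \<longrightarrow> (\<forall>u\<in>X. near G \<beta> (D L) x u)"
  then have X': "X = {x}" using bottom L by blast
  have "covers {} (x, m) undefined undefined v a b (64 * k * log 2 (card X) * (l b - l a))"
    if "v ` {a..b} \<subseteq> X" for v l a b
    unfolding covers_def using that X' by (intro exI[of _ "{(x, m)}"] exI[of _ "(x, m)"]) auto
  then have "hub L (x, m) X {} undefined undefined"
    unfolding hub_def arbor_def by auto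
  then show "\<exists>U par rk. hub L (x, m) X U par rk \<and> (\<forall>y\<in>U. m < snd y) \<and> r \<notin> fst ` U \<and>
        real (card U) + 1 \<le> card X powr (1 + 1 / k)"
    by (intro exI[of _ "{}"] exI) (auto simp: X')
qed

lemma buildable_0: "buildable 0"
  by (rule inc_induct[of 0 L]) (auto intro: buildable_bottom buildable_step)

section \<open>From the hierarchy to the path-tree embedding\<close>

lemma hub_covers_subgraph:
  assumes hub: "hub i \<rho> (verts G) U par rk" and fw: "finite_weights G"
    and H: "subgraph H G" "connected_wgraph H" "respecting h G H"
  obtains S t where "S \<subseteq> insert \<rho> U" "t \<in> S" "\<forall>y\<in>S - {t}. y \<in> U \<and> par y \<in> S"
    "(\<Sum>y\<in>S - {t}. D (rk y - 1)) \<le> ennreal (128 * real k * log 2 (card (verts G))) * weight H"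
    "verts H \<subseteq> fst ` S"
proof -
  have wf: "wf_wgraph H" and sub: "verts H \<subseteq> verts G" using H(1) by (auto simp: subgraph_def)
  have fwH: "finite_weights H" using H(1) fw by (auto simp: subgraph_def finite_weights_def)
  \<comment> \<open>The walk weighs at most twice as much as \<open>H\<close>, whence
    \<open>128 = 2 * 64\<close>.\<close>
  obtain u p v where p: "is_walk H u p v" "set p = verts H" "walk_weight H p \<le> 2 * weight H"
    by (rule double_tree_walk[OF wf H(2)])
  have ne: "p \<noteq> []" using p(1) by (simp add: is_walk_def)
  let ?l = "\<lambda>i. enn2real (walk_weight H (take (Suc i) p))" and ?m = "length p - 1"
  let ?K = "64 * k * log 2 (card (verts G))"
  have K: "0 \<le> ?K" by (simp add: log_card_mono(2))
  have "nth p ` {0..?m} \<subseteq> verts G"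
  proof
    fix x assume "x \<in> nth p ` {0..?m}"
    then obtain i where i: "i \<le> ?m" "x = p ! i" by auto
    then have "i < length p" using ne by (cases p) auto
    then have "x \<in> set p" using i(2) by simp
    then show "x \<in> verts G" using p(2) sub by blast
  qed
  then have "covers U \<rho> par rk (nth p) 0 ?m (?K * (?l ?m - ?l 0))"
    by (intro hubD(3)[OF hub] paced_walk[OF p(1) fwH sub H(3)]) auto
  then obtain S t where S: "S \<subseteq> insert \<rho> U" "t \<in> S" "\<forall>y\<in>S - {t}. y \<in> U \<and> par y \<in> S"
     "(\<Sum>y\<in>S - {t}. D (rk y - 1)) \<le> ennreal (?K * (?l ?m - ?l 0))" "\<forall>i\<in>{0..?m}. \<exists>y\<in>S. fst y = p ! i"
    unfolding covers_def by blast
  have "?l 0 = 0" using ne by (cases p) auto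
  moreover have "ennreal (?l ?m) = walk_weight H p"
    using ne walk_weight_finite[OF p(1) fwH] by simp
  ultimately have "ennreal (?K * (?l ?m - ?l 0)) = ennreal ?K * walk_weight H p"
    using K by (simp add: ennreal_mult'')
  also have "\<dots> \<le> ennreal ?K * (2 * weight H)" by (rule mult_left_mono[OF p(3)]) simp
  also have "\<dots> = ennreal (?K * 2) * weight H"
    by (subst ennreal_mult''[of 2]) (simp_all add: mult.assoc)
  also have "?K * 2 = 128 * real k * log 2 (card (verts G))" by simp
  finally have w: "(\<Sum>y\<in>S - {t}. D (rk y - 1)) \<le> ennreal (128 * real k * log 2 (card (verts G))) * weight H"
    using S(4) by (rule order_trans[rotated])
  have "verts H \<subseteq> fst ` S"
  proof
    fix x assume "x \<in> verts H"
    then obtain i where "i < length p" "x = p ! i" using p(2) by (metis in_set_conv_nth)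
    then have "\<exists>y\<in>S. fst y = x" using S(5) by auto
    then show "x \<in> fst ` S" by force
  qed
  with that S(1-3) w show ?thesis by blast
qed

lemma path_tree_embedding_exists:
  assumes wf: "wf_wgraph G" and fw: "finite_weights G" and r: "r \<in> verts G"
    and D0: "D 0 = \<infinity>" and Dpos: "\<And>i. 0 < D i"
  shows "\<exists>(T :: ('a \<times> nat) wgraph) f P.
       path_tree_embedding G T f P \<and> hop_bound T P (2 * real L * real \<beta>) \<and>
       real (card (\<Union>v\<in>verts G. f v)) \<le> card (verts G) powr (1 + 1 / k) \<and> card (f r) = 1 \<and>
       (\<forall>H. subgraph H G \<and> connected_wgraph H \<and> respecting h G H \<longrightarrow>
          (\<exists>H'. subgraph H' T \<and> connected_wgraph H' \<and> (\<forall>u\<in>verts H. verts H' \<inter> f u \<noteq> {}) \<and>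
             weight H' \<le> ennreal (128 * real k * log 2 (card (verts G))) * weight H))"
proof -
  define \<rho> where "\<rho> = (r, 0 :: nat)"
  obtain U par rk0 where U: "hub 0 \<rho> (verts G) U par rk0" "r \<notin> fst ` U"
    "real (card U) + 1 \<le> card (verts G) powr (1 + 1 / k)"
    using buildable_0[unfolded buildable_def, rule_format, of "verts G" r 0] r unfolding \<rho>_def by blast
  \<comment> \<open>The hierarchy leaves the rank of the root open; \<open>rooted_tree\<close> wants
    0.\<close>
  define rk where "rk = rk0(\<rho> := 0)"
  have \<rho>U: "\<rho> \<notin> U" by (rule arborD(2)[OF hubD(1)[OF U(1)]])
  have hub: "hub 0 \<rho> (verts G) U par rk"
    by (rule hub_cong[OF U(1)]) (use \<rho>U in \<open>auto simp: rk_def\<close>)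
  note A = arborD[OF hubD(1)[OF hub]]
  have rk\<rho>: "rk \<rho> = 0" by (simp add: rk_def)
  define ew where "ew j = D (j - 1)" for j
  interpret rooted_tree U \<rho> par rk L ew
  proof
    fix y assume y: "y \<in> U"
    show "rk (par y) < rk y"
      using A(3)[OF y] A(4)[OF y] A(6)[OF y] rk\<rho> by auto
  qed (use A rk\<rho> Dpos in \<open>auto simp: ew_def\<close>)
  have verts: "fst y \<in> verts G" if "y \<in> insert \<rho> U" for y
    using that hubD(2)[OF hub] r by (auto simp: \<rho>_def)
  have "\<exists>p. is_path G (fst y) p (fst (par y)) \<and> hop p \<le> \<beta> \<and> walk_weight G p \<le> D (rk y - 1)"
    if "y \<in> U" "1 < rk y" for y
    using nearE_path[OF A(7)[OF that]] by metis
  then obtain pp where pp: "\<And>y. y \<in> U \<Longrightarrow> 1 < rk y \<Longrightarrow>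
      is_path G (fst y) (pp y) (fst (par y)) \<and> hop (pp y) \<le> \<beta> \<and> walk_weight G (pp y) \<le> D (rk y - 1)"
    by metis
  define P where "P = (\<lambda>x y. if x \<in> U \<and> y = par x then pp x else rev (pp y))"
  have up: "is_path G (fst x) (pp x) (fst (par x)) \<and> hop (pp x) \<le> \<beta> \<and>
      walk_weight G (pp x) \<le> wt tree_graph {x, par x} \<and> P x (par x) = pp x \<and> P (par x) x = rev (pp x)"
    if x: "x \<in> U" and fin: "wt tree_graph {x, par x} < \<infinity>" for x
  proof -
    have w: "wt tree_graph {x, par x} = D (rk x - 1)" using weight_edge[OF x] by (simp add: ew_def)
    \<comment> \<open>Rank 1 would mean weight \<open>D 0 = \<infinity>\<close>, so every finite
      edge has a path.\<close>
    have "1 < rk x"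
    proof (rule ccontr)
      assume "\<not> 1 < rk x"
      then show False using fin w D0 by simp
    qed
    moreover have "\<not> (par x \<in> U \<and> x = par (par x))" using rank[OF x] rank[of "par x"] by auto
    ultimately show ?thesis using pp[OF x] x w by (auto simp: P_def)
  qed
  have edge: "is_path G (fst x) (P x y) (fst y) \<and> hop (P x y) \<le> \<beta> \<and>
      walk_weight G (P x y) \<le> wt tree_graph {x, y} \<and> P y x = rev (P x y)"
    if "{x, y} \<in> edges tree_graph" and fin: "wt tree_graph {x, y} < \<infinity>" for x y
    using that(1)
  proof (cases rule: edge_cases)
    case 1
    then show ?thesis using up[OF 1(1)] fin by simp
  next
    case 2
    then have "wt tree_graph {y, par y} < \<infinity>" using fin by (simp only: insert_commute)
    from up[OF 2(1) this] show ?thesis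
      using 2 by (simp only: is_path_rev hop_rev walk_weight_rev rev_rev_ident insert_commute[of "par y" y])
  qed
  define f where "f = (\<lambda>v. {y \<in> insert \<rho> U. fst y = v})"
  have one: "one_to_many_embedding G tree_graph f"
    unfolding one_to_many_embedding_def
  proof (intro conjI ballI impI)
    fix v assume v: "v \<in> verts G"
    \<comment> \<open>A sequence with the single entry \<open>v\<close> is paced, so its cover
      contains a copy of \<open>v\<close>.\<close>
    have "hop_dist h G v v \<le> walk_weight G [v]"
      unfolding hop_dist_def
      by (rule INF_lower) (use v in \<open>auto simp: is_path_def is_walk_single hop_def\<close>)
    then have "paced h G (\<lambda>_. v) (\<lambda>_. 0) 0 0" by (simp add: paced_def)
    from hubD(3)[OF hub _ this] v obtain y where "y \<in> insert \<rho> U" "fst y = v"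
      unfolding covers_def by auto
    then show "f v \<noteq> {}" unfolding f_def by blast
    show "f v \<subseteq> verts tree_graph" by (auto simp: f_def)
  next
    fix u v :: 'a assume "u \<noteq> v"
    then show "f u \<inter> f v = {}" by (auto simp: f_def)
  qed
  have dom: "dominating G tree_graph f"
    unfolding dominating_def
  proof (intro ballI)
    fix u v u' v' assume uv: "u \<in> verts G" "v \<in> verts G" "u' \<in> f u" "v' \<in> f v"
    have "wdist G u v \<le> walk_weight tree_graph q" if q: "is_path tree_graph u' q v'" for q
    proof (cases "walk_weight tree_graph q < \<infinity>")
      case True
      have "\<exists>p. is_walk G (fst u') p (fst v') \<and> walk_weight G p \<le> walk_weight tree_graph q"
      proof (rule project_walk[where T = tree_graph])
        show "\<exists>p. is_walk G (fst x) p (fst y) \<and> walk_weight G p \<le> wt tree_graph {x, y}"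
          if "{x, y} \<in> edges tree_graph" "wt tree_graph {x, y} < \<infinity>" for x y
          using edge[OF that] unfolding is_path_def by blast
        show "fst x \<in> verts G" if "x \<in> verts tree_graph" for x
          using that by (intro verts) simp
      qed (use q True in \<open>auto simp: is_path_def\<close>)
      moreover have "fst u' = u" "fst v' = v" using uv by (auto simp: f_def)
      ultimately show ?thesis using wdist_le_walk_weight[of G u _ v] order_trans by metis
    qed (simp add: not_less top_unique)
    then show "wdist G u v \<le> wdist tree_graph u' v'"
      unfolding wdist_def[of tree_graph] by (auto intro: INF_greatest)
  qed
  have Uf: "(\<Union>v\<in>verts G. f v) = insert \<rho> U"
    using verts by (auto simp: f_def)
  have "path_tree_embedding G tree_graph f P"
    unfolding path_tree_embedding_def
  proof (intro conjI tree_graph_wf tree_tree_graph one dom ballI impI)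
    show "(\<Union>v\<in>verts G. f v) = verts tree_graph" using Uf by simp
    fix u v u' v' assume uv: "u' \<in> f u" "v' \<in> f v" and e: "{u', v'} \<in> edges tree_graph \<and> wt tree_graph {u', v'} < \<infinity>"
    have "fst u' = u" "fst v' = v" using uv by (auto simp: f_def)
    then show "is_path G u (P u' v') v" "walk_weight G (P u' v') \<le> wt tree_graph {u', v'}" "P v' u' = rev (P u' v')"
      using edge e by blast+
  qed
  moreover have "hop_bound tree_graph P (2 * real L * real \<beta>)"
    unfolding hop_bound_def
  proof (intro ballI allI impI, elim conjE)
    fix u' v' q assume uv: "u' \<in> verts tree_graph" "v' \<in> verts tree_graph" and q: "is_path tree_graph u' q v'"
      and fin: "\<forall>e\<in>set (walk_edges q). wt tree_graph e < \<infinity>"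
    have q': "q \<noteq> []" "distinct q" "set (walk_edges q) \<subseteq> edges tree_graph" "hd q = u'" "last q = v'"
      using q by (auto simp: is_path_def is_walk_def simp del: tree_graph_simps)
    \<comment> \<open>A tree path has at most \<open>2 * L\<close> edges, each carrying at most
      \<open>\<beta>\<close> hops.\<close>
    have "length q - 1 \<le> rk u' + rk v'" using path_length_le[OF q'(1-3)] q'(4,5) by simp
    also have "\<dots> \<le> L + L" using uv by (intro add_mono rank_le') simp_all
    finally have "length q - 1 \<le> 2 * L" by simp
    have "hop (induced_walk P q) \<le> \<beta> * (length q - 1)"
      using edge fin q'(3) by (intro hop_induced_walk_le) blast
    also have "\<dots> \<le> \<beta> * (2 * L)" using \<open>length q - 1 \<le> 2 * L\<close> by (rule mult_left_mono) simp
    finally have "hop (induced_walk P q) \<le> 2 * L * \<beta>" by (simp add: mult.commute)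
    then show "real (hop (induced_walk P q)) \<le> 2 * real L * real \<beta>"
      by (metis of_nat_le_iff of_nat_mult of_nat_numeral)
  qed
  moreover have "real (card (\<Union>v\<in>verts G. f v)) \<le> card (verts G) powr (1 + 1 / k)"
    unfolding Uf using U(3) A(1,2) by simp
  moreover have "card (f r) = 1"
  proof -
    have "f r = {\<rho>}" using U(2) by (force simp: f_def \<rho>_def)
    then show ?thesis by simp
  qed
  moreover have "\<exists>H'. subgraph H' tree_graph \<and> connected_wgraph H' \<and> (\<forall>u\<in>verts H. verts H' \<inter> f u \<noteq> {}) \<and>
             weight H' \<le> ennreal (128 * real k * log 2 (card (verts G))) * weight H"
    if H: "subgraph H G" "connected_wgraph H" "respecting h G H" for H
  proof -
    obtain S t where S: "S \<subseteq> insert \<rho> U" "t \<in> S" "\<forall>y\<in>S - {t}. y \<in> U \<and> par y \<in> S"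
      "(\<Sum>y\<in>S - {t}. D (rk y - 1)) \<le> ennreal (128 * real k * log 2 (card (verts G))) * weight H" "verts H \<subseteq> fst ` S"
      using hub_covers_subgraph[OF hub fw H] by metis
    then have "pruned S t" by (simp add: pruned_def)
    note sub = pruned_subgraph[OF this]
    have "verts (sub_tree S t) \<inter> f u \<noteq> {}" if "u \<in> verts H" for u
      using that S(1,5) by (force simp: f_def)
    then show ?thesis using sub S(4) unfolding ew_def[symmetric] by (intro exI[of _ "sub_tree S t"]) simp
  qed
  ultimately show ?thesis by blast
qed

end

section \<open>Scales of a graph with polynomial aspect ratio\<close>

lemma weight_bounds:
  assumes wf: "wf_wgraph G" and fw: "finite_weights G" and asp: "aspect_ratio G \<le> ennreal b" and b: "1 \<le> b"
  obtains lo hi :: real where "0 < lo" "0 < hi" "\<And>e. e \<in> edges G \<Longrightarrow> ennreal lo \<le> wt G e \<and> wt G e \<le> ennreal hi" "hi \<le> lo * b"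
proof (cases "edges G = {}")
  case True
  then show ?thesis using that[of 1 1] b by auto
next
  case False
  have "edges G \<subseteq> Pow (verts G)" using wf by (auto simp: wf_wgraph_def)
  then have finE: "finite (edges G)" using wf finite_subset by (auto simp: wf_wgraph_def)
  let ?W = "wt G ` edges G"
  have W: "finite ?W" "?W \<noteq> {}" using finE False by auto
  have pos: "0 < x" "x < top" if "x \<in> ?W" for x
    using that wf fw by (auto simp: wf_wgraph_def finite_weights_def)
  define lo hi where "lo = enn2real (Min ?W)" and "hi = enn2real (Max ?W)"
  have lo: "ennreal lo = Min ?W" "0 < lo" and hi: "ennreal hi = Max ?W" "0 < hi"
    using pos[OF Min_in[OF W]] pos[OF Max_in[OF W]] by (auto simp: lo_def hi_def enn2real_positive_iff)
  have "ennreal hi / ennreal lo \<le> ennreal b"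
    using asp unfolding aspect_ratio_eq_Max_Min[OF finE False] lo hi .
  then have "hi / lo \<le> b" using lo(2) hi(2) b by (simp add: divide_ennreal)
  then have "hi \<le> lo * b" using lo(2) by (simp add: field_simps)
  moreover have "ennreal lo \<le> wt G e \<and> wt G e \<le> ennreal hi" if "e \<in> edges G" for e
    unfolding lo hi using that W(1) by simp
  ultimately show ?thesis using that lo hi by blast
qed

lemma path_weight_le:
  fixes hi :: real
  assumes p: "is_path G u p v" and fin: "finite (verts G)"
    and hi: "\<And>e. e \<in> edges G \<Longrightarrow> wt G e \<le> ennreal hi" "0 \<le> hi"
  shows "walk_weight G p \<le> ennreal (card (verts G) * hi)"
proof -
  have "sum_list (map (wt G) es) \<le> ennreal (length es * hi)" if "set es \<subseteq> edges G" for es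
    using that
  proof (induction es)
    case (Cons e es)
    then have "wt G e + sum_list (map (wt G) es) \<le> ennreal hi + ennreal (length es * hi)"
      using hi by (intro add_mono) auto
    also have "\<dots> = ennreal (length (e # es) * hi)"
      using hi(2) by (simp add: distrib_right flip: ennreal_plus)
    finally show ?case by simp
  qed simp
  then have "walk_weight G p \<le> ennreal (length (walk_edges p) * hi)"
    using p by (simp add: walk_weight_def is_path_def is_walk_def)
  also have "length (walk_edges p) \<le> card (verts G)"
  proof -
    have "length p \<le> card (verts G)"
      using p fin distinct_card[of p] card_mono[of "verts G" "set p"] by (simp add: is_path_def is_walk_def)
    then show ?thesis by (simp add: length_walk_edges)
  qed
  then have "ennreal (length (walk_edges p) * hi) \<le> ennreal (card (verts G) * hi)"
    using hi(2) by (intro ennreal_leI mult_right_mono) auto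
  finally show ?thesis .
qed

text \<open>\<open>D 1 = n * hi\<close> bounds the weight of every path, which allows the jump from
  \<open>D 0 = \<infinity>\<close>; from there the radii are halved until \<open>D L\<close> is
  below the lower bound \<open>lo\<close> on edge weights. The aspect ratio makes
  \<open>O(log n)\<close> levels enough.\<close>

lemma embedding_bounds:
  fixes G :: "'a wgraph"
  assumes wf: "wf_wgraph G" and fw: "finite_weights G" and asp: "aspect_ratio G \<le> ennreal (card (verts G) powr c)"
    and k: "1 \<le> k" and r: "r \<in> verts G"
  shows "\<exists>L. real L \<le> (max 0 c + 4) * log1 (card (verts G)) \<and> (\<exists>D. hop_hierarchy G h k (nat \<lfloor>4 * real k * log 2 (card (verts G))\<rfloor> * h) L D \<and>
    D 0 = \<infinity> \<and> (\<forall>i. 0 < D i))"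
proof -
  let ?n = "real (card (verts G))"
  \<comment> \<open>Negative exponents are replaced by 0 because \<open>weight_bounds\<close> wants
    a ratio bound of at least 1.\<close>
  define c' where "c' = max 0 c"
  have fin: "finite (verts G)" using wf by (simp add: wf_wgraph_def)
  have n: "1 \<le> ?n" using r fin by (simp add: Suc_le_eq card_gt_0_iff) blast
  have b: "1 \<le> ?n powr c'" using n by (simp add: ge_one_powr_ge_zero c'_def)
  have "?n powr c \<le> ?n powr c'" using n by (intro powr_mono) (auto simp: c'_def)
  then have "aspect_ratio G \<le> ennreal (?n powr c')" using asp ennreal_leI order_trans by blast
  then obtain lo hi where lo: "0 < lo" and hi: "0 < hi"
    and e: "\<And>e. e \<in> edges G \<Longrightarrow> ennreal lo \<le> wt G e \<and> wt G e \<le> ennreal hi" and lohi: "hi \<le> lo * ?n powr c'"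
    using weight_bounds[OF wf fw _ b] by metis
  define D where "D i = (if i = 0 then \<infinity> else ennreal (?n * hi / 2 ^ (i - 1)))" for i :: nat
  \<comment> \<open>\<open>D L\<close> divides by \<open>2 ^ (L - 1)\<close>, so one extra level
    makes up for the index shift; the other makes \<open>D L < lo\<close> strict.\<close>
  define L where "L = nat \<lceil>(1 + c') * log 2 ?n\<rceil> + 2"
  have ln: "0 \<le> (1 + c') * log 2 ?n" using n by (simp add: c'_def)
  have "real L \<le> (1 + c') * log 2 ?n + 3" unfolding L_def using ln by linarith
  also have "\<dots> \<le> (1 + c') * log1 (card (verts G)) + 3 * log1 (card (verts G))"
    by (intro add_mono mult_left_mono) (auto simp: log1_def c'_def)
  finally have Lb: "real L \<le> (max 0 c + 4) * log1 (card (verts G))" by (simp add: algebra_simps c'_def)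
  have DL: "D L < ennreal lo"
  proof -
    have "?n powr (1 + c') = 2 powr ((1 + c') * log 2 ?n)"
      using n by (simp add: powr_def log_def)
    also have "\<dots> < 2 powr real (L - 1)"
      unfolding L_def using ln by (intro powr_less_mono) linarith+
    also have "\<dots> = 2 ^ (L - 1)" by (simp add: powr_realpow)
    finally have *: "?n powr (1 + c') < 2 ^ (L - 1)" .
    have "?n * hi \<le> ?n * (lo * ?n powr c')" using lohi by (intro mult_left_mono) auto
    also have "\<dots> = lo * ?n powr (1 + c')" using n by (simp add: powr_add)
    also have "\<dots> < lo * 2 ^ (L - 1)" using * lo by simp
    finally have "?n * hi / 2 ^ (L - 1) < lo" by (simp add: field_simps)
    then show ?thesis using lo by (simp add: D_def L_def ennreal_lessI)
  qed
  have "hop_hierarchy G h k (nat \<lfloor>4 * real k * log 2 ?n\<rfloor> * h) L D"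
  proof
    show "2 * D (Suc i) \<le> D i" for i
    proof (cases i)
      case (Suc j)
      have "2 * D (Suc i) = ennreal 2 * ennreal (?n * hi / 2 ^ Suc j)" using Suc by (simp add: D_def)
      also have "\<dots> = ennreal (?n * hi / 2 ^ j)" using hi by (subst ennreal_mult[symmetric]) auto
      also have "\<dots> = D i" using Suc by (simp add: D_def)
      finally show ?thesis by simp
    qed (simp add: D_def)
    show "j * h \<le> nat \<lfloor>4 * real k * log 2 ?n\<rfloor> * h" if "real j \<le> 4 * real k * log 2 ?n" for j
    proof -
      have "j \<le> nat \<lfloor>4 * real k * log 2 ?n\<rfloor>" using that by linarith
      then show ?thesis by simp
    qed
    show "near G b (D (Suc i)) u v" if i: "i < L" and near: "near G b (D i * ennreal (1 / 2)) u v" for i b u v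
    proof (cases i)
      case 0
      obtain p where p: "is_path G u p v" "hop p \<le> b" using nearE_path[OF near] by metis
      have "walk_weight G p \<le> ennreal (?n * hi)" using path_weight_le[OF p(1) fin] e hi by simp
      then show ?thesis using p 0 by (auto simp: near_def is_path_def D_def)
    next
      case (Suc j)
      have "D i * ennreal (1 / 2) = ennreal (?n * hi / 2 ^ j * (1 / 2))"
        unfolding D_def using hi Suc by (subst ennreal_mult) auto
      also have "\<dots> = D (Suc i)" by (simp add: D_def Suc mult.commute)
      finally have "D i * ennreal (1 / 2) = D (Suc i)" .
      then show ?thesis using near by simp
    qed
    show "u = v" if near: "near G (nat \<lfloor>4 * real k * log 2 ?n\<rfloor> * h) (D L) u v" for u v
    proof -
      obtain p where p: "is_walk G u p v" "walk_weight G p \<le> D L" using near by (auto simp: near_def)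
      consider "p = []" | x where "p = [x]" | x y q where "p = x # y # q"
        by (metis neq_Nil_conv)
      then show ?thesis
      proof cases
        case (3 x y q)
        then have "ennreal lo \<le> wt G {x, y}" using p(1) e by (simp add: is_walk_Cons)
        also have "\<dots> \<le> walk_weight G p" using 3 by simp
        also have "\<dots> < ennreal lo" using p(2) DL by (rule le_less_trans)
        finally show ?thesis by simp
      qed (use p in \<open>auto simp: is_walk_def\<close>)
    qed
  qed (use fin k in \<open>auto simp: L_def\<close>)
  moreover have "0 < D i" for i using hi n by (simp add: D_def)
  moreover have "D 0 = \<infinity>" by (simp add: D_def)
  ultimately show ?thesis using Lb by blast
qed

theorem corollary1:
  fixes c :: real
  shows "\<exists>C\<^sub>1 > 0. \<exists>C\<^sub>2 > 0. \<forall>(G :: 'a wgraph) (n :: nat) (h :: nat) (k :: nat) (r :: 'a).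
    wf_wgraph G \<and> finite_weights G \<and> n = card (verts G) \<and>
    aspect_ratio G \<le> ennreal (real n powr c) \<and>
    1 \<le> h \<and> 1 \<le> k \<and> r \<in> verts G \<longrightarrow>
    (\<exists>(T :: ('a \<times> nat) wgraph) f P.
       path_tree_embedding G T f P \<and>
       hop_bound T P ((C\<^sub>1 * real k * (log1 n)\<^sup>2) * real h) \<and>
       real (card (\<Union>v\<in>verts G. f v)) \<le> (2 * real n) powr (1 + 1 / real k) \<and>
       card (f r) = 1 \<and>
       (\<forall>H. subgraph H G \<and> connected_wgraph H \<and> respecting h G H \<longrightarrow>
          (\<exists>H'. subgraph H' T \<and> connected_wgraph H' \<and>
             (\<forall>u\<in>verts H. verts H' \<inter> f u \<noteq> {}) \<and>
             weight H' \<le> ennreal (C\<^sub>2 * real k * log1 n) * weight H)))"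
proof -
  \<comment> \<open>The hop bound is \<open>2 * L * \<beta>\<close>, with
    \<open>L \<le> (max 0 c + 4) * log1 n\<close> and
    \<open>\<beta> \<le> 4 * k * log1 n * h\<close>.\<close>
  define C1 where "C1 = 8 * (max 0 c + 4)"
  have C1: "0 < C1" by (simp add: C1_def)
  have main: "\<exists>(T :: ('a \<times> nat) wgraph) f P.
       path_tree_embedding G T f P \<and>
       hop_bound T P ((C1 * real k * (log1 n)\<^sup>2) * real h) \<and>
       real (card (\<Union>v\<in>verts G. f v)) \<le> (2 * real n) powr (1 + 1 / real k) \<and>
       card (f r) = 1 \<and>
       (\<forall>H. subgraph H G \<and> connected_wgraph H \<and> respecting h G H \<longrightarrow>
          (\<exists>H'. subgraph H' T \<and> connected_wgraph H' \<and>
             (\<forall>u\<in>verts H. verts H' \<inter> f u \<noteq> {}) \<and>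
             weight H' \<le> ennreal (128 * real k * log1 n) * weight H))"
    if G: "wf_wgraph G" "finite_weights G" "n = card (verts G)" "aspect_ratio G \<le> ennreal (real n powr c)"
      and k: "1 \<le> k" and r: "r \<in> verts G" for G :: "'a wgraph" and n h k r
  proof -
    let ?\<beta> = "nat \<lfloor>4 * real k * log 2 n\<rfloor> * h"
    obtain L D where Lb: "real L \<le> (max 0 c + 4) * log1 n" and "hop_hierarchy G h k ?\<beta> L D"
      and D0: "D 0 = \<infinity>" "\<And>i. 0 < D i"
      using embedding_bounds[OF G(1,2) G(4)[unfolded G(3)] k r] G(3) by metis
    interpret hop_hierarchy G h k ?\<beta> L D r by fact
    obtain T :: "('a \<times> nat) wgraph" and f P where T: "path_tree_embedding G T f P"
      "hop_bound T P (2 * real L * real ?\<beta>)"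
      "real (card (\<Union>v\<in>verts G. f v)) \<le> n powr (1 + 1 / k)" "card (f r) = 1"
      "\<And>H. subgraph H G \<Longrightarrow> connected_wgraph H \<Longrightarrow> respecting h G H \<Longrightarrow>
          \<exists>H'. subgraph H' T \<and> connected_wgraph H' \<and> (\<forall>u\<in>verts H. verts H' \<inter> f u \<noteq> {}) \<and>
             weight H' \<le> ennreal (128 * real k * log 2 n) * weight H"
      using path_tree_embedding_exists[OF G(1,2) r D0] unfolding G(3)[symmetric] by blast
    have l: "0 \<le> log 2 n" "log 2 n \<le> log1 n" "0 \<le> log1 n"
      unfolding G(3) by (auto simp: log_card_mono(2) log1_def)
    have "real ?\<beta> \<le> 4 * real k * log 2 n * real h"
      using l(1) by (simp add: mult_right_mono)
    also have "\<dots> \<le> 4 * real k * log1 n * real h" using l by (intro mult_right_mono mult_left_mono) auto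
    finally have "2 * real L * real ?\<beta> \<le> 2 * ((max 0 c + 4) * log1 n) * (4 * real k * log1 n * real h)"
      using Lb l by (intro mult_mono) auto
    also have "\<dots> = C1 * real k * (log1 n)\<^sup>2 * real h" by (simp add: C1_def power2_eq_square)
    finally have "hop_bound T P (C1 * real k * (log1 n)\<^sup>2 * real h)"
      using T(2) unfolding hop_bound_def by (meson order_trans)
    moreover have "real (card (\<Union>v\<in>verts G. f v)) \<le> (2 * real n) powr (1 + 1 / real k)"
      using T(3) by (rule order_trans) (intro powr_mono2, auto)
    moreover have "\<exists>H'. subgraph H' T \<and> connected_wgraph H' \<and> (\<forall>u\<in>verts H. verts H' \<inter> f u \<noteq> {}) \<and>
             weight H' \<le> ennreal (128 * real k * log1 n) * weight H"
      if H: "subgraph H G" "connected_wgraph H" "respecting h G H" for H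
    proof -
      have "ennreal (128 * real k * log 2 n) * weight H \<le> ennreal (128 * real k * log1 n) * weight H"
        using l by (intro mult_right_mono ennreal_leI mult_left_mono) auto
      with T(5)[OF H] show ?thesis by (meson order_trans)
    qed
    ultimately show ?thesis using T(1,4) by blast
  qed
  show ?thesis
  proof (rule exI[of _ C1], rule conjI[OF C1], rule exI[of _ "128 :: real"], intro conjI[OF zero_less_numeral] allI impI, goal_cases)
    case (1 G n h k r)
    then show ?case by (elim conjE) (rule main[where G = G and n = n and h = h and k = k and r = r])
  qed
qed

end
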